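(* Assume that $\mathfrak{c}=\omega_2$, $\mathrm{non}(\mathcal{N})=\omega_1$ and $\mathrm{cov}(\mathcal{N}_{\omega_2})=\mathfrak{c}$. Let $K$ be a compact space of countable $\pi$-character supporting a measure. Then $K$ has a countable $\pi$-base.
   Context: $\mathfrak{c}=2^{\aleph_0}$. For a cardinal $\kappa$, $\lambda_\kappa$ is the standard product probability measure on $2^\kappa$ (product of the uniform measures on $\{0,1\}$; all Borel sets are measurable for its completion), and $\mathcal{N}_\kappa$ is the ideal of $\lambda_\kappa$-null subsets of $2^\kappa$; $\mathcal{N}=\mathcal{N}_\omega$. For an ideal $\mathcal{I}$ on a set $S$: $\mathrm{non}(\mathcal{I})=\min\{|X|\colon X\subseteq S,\ X\notin\mathcal{I}\}$ and $\mathrm{cov}(\mathcal{I})=\min\{|\mathcal{A}|\colon \mathcal{A}\subseteq\mathcal{I},\ \bigcup\mathcal{A}=S\}$. Compact spaces are Hausdorff. A measure on a topological space is a finite Borel measure that is Radon, i.e. inner regular with respect to compact sets. A space $K$ supports a measure if there is a measure $\mu$ on $K$ with $\mu(U)>0$ for every nonempty open $U\subseteq K$. For $x\in K$, a family $\mathcal{P}$ of nonempty open sets is a $\pi$-base at $x$ if for every open $V\ni x$ there is $U\in\mathcal{P}$ with $U\subseteq V$. $K$ has countable $\pi$-character if every $x\in K$ has a countable $\pi$-base at $x$. A $\pi$-base of $K$ is a family $\mathcal{P}$ of nonempty open sets such that every nonempty open $V\subseteq K$ contains some $U\in\mathcal{P}$. *)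

theory Defs
  imports "HOL-Probability.Probability"
begin

unbundle cardinal_syntax

definition omega1 :: "nat set rel" where
  "omega1 = cardSuc natLeq"

definition omega2 :: "nat set set rel" where
  "omega2 = cardSuc omega1"

definition continuum :: "(nat \<Rightarrow> bool) rel" where
  "continuum = ctwo ^c natLeq"

text \<open>
  The least cardinality of a member of \<open>F\<close>, as a cardinal order relation. It is only
  meaningful for \<open>F \<noteq> {}\<close>, and, like all cardinals here, only up to \<open>=o\<close>.
\<close>
definition min_card :: "'a set set \<Rightarrow> 'a rel" where
  "min_card F = |SOME X. X \<in> F \<and> (\<forall>Y\<in>F. |X| \<le>o |Y| )|"

lemma min_card_attained:
  assumes "F \<noteq> {}"
  obtains X where "X \<in> F" "min_card F = |X|" "\<And>Y. Y \<in> F \<Longrightarrow> |X| \<le>o |Y|"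
proof -
  have "\<exists>r \<in> card_of ` F. \<forall>r' \<in> card_of ` F. r \<le>o r'"
    using assms by (intro exists_minim_Well_order) (auto simp: card_of_Well_order)
  then have "\<exists>X. X \<in> F \<and> (\<forall>Y\<in>F. |X| \<le>o |Y| )"
    by blast
  from someI_ex[OF this] show thesis
    using that[of "SOME X. X \<in> F \<and> (\<forall>Y\<in>F. |X| \<le>o |Y| )"]
    unfolding min_card_def by blast
qed

definition non_ideal :: "'a set \<Rightarrow> 'a set set \<Rightarrow> 'a rel" where
  "non_ideal S \<I> = min_card {X. X \<subseteq> S \<and> X \<notin> \<I>}"

definition cov_ideal :: "'a set \<Rightarrow> 'a set set \<Rightarrow> 'a set rel" where
  "cov_ideal S \<I> = min_card {\<A>. \<A> \<subseteq> \<I> \<and> \<Union>\<A> = S}"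

text \<open>
  The cube \<open>2\<^sup>I\<close> consists of the functions \<open>I \<rightarrow> bool\<close> that are \<open>undefined\<close> outside \<open>I\<close>.
\<close>
definition cantor_cube :: "'i set \<Rightarrow> ('i \<Rightarrow> bool) set" where
  "cantor_cube I = (I \<rightarrow>\<^sub>E UNIV)"

definition cube_measure :: "'i set \<Rightarrow> ('i \<Rightarrow> bool) measure" where
  "cube_measure I = PiM I (\<lambda>_. uniform_count_measure (UNIV :: bool set))"

text \<open>
  For uncountable \<open>I\<close> the product \<open>\<sigma>\<close>-algebra is smaller than the Borel one, but its completion
  contains all Borel sets, so the null ideal is that of the completed Borel measure.
\<close>
definition cube_null :: "'i set \<Rightarrow> ('i \<Rightarrow> bool) set set" where
  "cube_null I = null_sets (completion (cube_measure I))"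

lemma space_cube_measure: "space (cube_measure I) = cantor_cube I"
  by (simp add: cube_measure_def cantor_cube_def space_PiM space_uniform_count_measure)

text \<open>
  The compact sets in the supremum are measurable when \<open>K\<close> is Hausdorff, the only case of interest.
\<close>
definition radon_measure_on :: "'a topology \<Rightarrow> 'a measure \<Rightarrow> bool" where
  "radon_measure_on K \<mu> \<longleftrightarrow>
     space \<mu> = topspace K \<and>
     sets \<mu> = sigma_sets (topspace K) {U. openin K U} \<and>
     finite_measure \<mu> \<and>
     (\<forall>B \<in> sets \<mu>. emeasure \<mu> B = (SUP C \<in> {C. compactin K C \<and> C \<subseteq> B}. emeasure \<mu> C))"

definition supports_measure :: "'a topology \<Rightarrow> bool" where
  "supports_measure K \<longleftrightarrow>
     (\<exists>\<mu>. radon_measure_on K \<mu> \<and> (\<forall>U. openin K U \<and> U \<noteq> {} \<longrightarrow> emeasure \<mu> U > 0))"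

definition pi_base_at :: "'a topology \<Rightarrow> 'a \<Rightarrow> 'a set set \<Rightarrow> bool" where
  "pi_base_at K x \<P> \<longleftrightarrow>
     (\<forall>U\<in>\<P>. openin K U \<and> U \<noteq> {}) \<and>
     (\<forall>V. openin K V \<and> x \<in> V \<longrightarrow> (\<exists>U\<in>\<P>. U \<subseteq> V))"

definition countable_pi_character :: "'a topology \<Rightarrow> bool" where
  "countable_pi_character K \<longleftrightarrow> (\<forall>x \<in> topspace K. \<exists>\<P>. countable \<P> \<and> pi_base_at K x \<P>)"

definition pi_base :: "'a topology \<Rightarrow> 'a set set \<Rightarrow> bool" where
  "pi_base K \<P> \<longleftrightarrow>
     (\<forall>U\<in>\<P>. openin K U \<and> U \<noteq> {}) \<and>
     (\<forall>V. openin K V \<and> V \<noteq> {} \<longrightarrow> (\<exists>U\<in>\<P>. U \<subseteq> V))"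

end

theory Submission
  imports Defs
begin

text \<open>
  Since \<open>K\<close> has countable \<open>\<pi>\<close>-character, it suffices to find a countable dense set.

  Every Borel probability on \<open>2\<^sup>I\<close> is the image of the product measure on \<open>2\<^bsup>I \<times> \<omega>\<^esup>\<close>, by sampling
  the coordinates successively from their conditional distributions. Thus \<open>cov(\<N>\<^bsub>\<omega>\<^sub>2\<^esub>) > \<omega>\<^sub>1\<close> gives
  points of \<open>K\<close> avoiding \<open>\<omega>\<^sub>1\<close> many null events, and \<open>non(\<N>) = \<omega>\<^sub>1\<close> gives, for every Borel
  probability on \<open>2\<^sup>\<omega>\<close>, a set of size \<open>\<omega>\<^sub>1\<close> meeting all sets of positive measure. By the former,
  a random sequence hits any \<open>\<omega>\<^sub>1\<close> given nonempty open sets, so every set of size \<open>\<omega>\<^sub>1\<close> lies in the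
  closure of a countable set.

  If \<open>K\<close> is not separable, then on some nonempty open \<open>W\<close> closures of sets of size \<open>\<omega>\<^sub>1\<close> are null. Given
  countably many open sets, a set of \<open>\<omega>\<^sub>1\<close> points obtained from Lebesgue density in \<open>2\<^sup>\<omega>\<close> has the
  property that each neighbourhood of it meets every event of positive measure that they generate, while its
  closure is null. Iterating this \<open>\<omega>\<^sub>1\<close> times and choosing a random point outside all of these
  null sets contradicts the existence of a countable \<open>\<pi>\<close>-base at this point.
\<close>

subsection \<open>Sampling a measure on \<open>2\<^sup>I\<close> from independent coordinates\<close>

text \<open>The events of interest live in K, but cov speaks of null sets of a cube. Events are
  therefore recorded as bits \<open>x \<in> U i\<close>, and samples are drawn from the law of these
  bits. A sampled bit pattern need not be the record of any point of K. If it avoids the null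
  cylinders over finite sets of indices, compactness gives a point, but only in the closures of the
  sets that the pattern selects. Hence closures appear wherever sets are shrunk: an open set to be
  hit is replaced by one with closure inside it, and only complements of open sets are read off
  exactly. The two cardinal invariants meet at \<open>omega1\<close>: non bounds the number of
  points from which one family of neighbourhoods is made, so that their closure is null, and cov
  leaves room for avoiding \<open>omega1\<close> many families at once. The length
  \<open>omega1\<close> suits the countable \<pi>-base at the end, since countably many hulls all
  appear by one stage. The continuum being \<open>omega2\<close> puts cov strictly above
  \<open>omega1\<close>, and lets the indices, of type \<open>nat set \<times> nat\<close>, be
  embedded into \<open>omega2\<close>.\<close>

abbreviation bits :: "('i \<Rightarrow> bool) measure" where
  "bits \<equiv> PiM UNIV (\<lambda>_. count_space UNIV)"

lemma space_bits [simp]: "space bits = UNIV"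
  by (simp add: space_PiM)

lemma measurable_to_bits:
  "f \<in> M \<rightarrow>\<^sub>M bits \<longleftrightarrow> (\<forall>i. (\<lambda>x. f x i) \<in> M \<rightarrow>\<^sub>M count_space UNIV)"
proof
  assume "f \<in> M \<rightarrow>\<^sub>M bits"
  then show "\<forall>i. (\<lambda>x. f x i) \<in> M \<rightarrow>\<^sub>M count_space UNIV"
    by (auto intro: measurable_PiM_component_rev measurable_compose[OF _ measurable_component_singleton])
next
  assume "\<forall>i. (\<lambda>x. f x i) \<in> M \<rightarrow>\<^sub>M count_space UNIV"
  then show "f \<in> M \<rightarrow>\<^sub>M bits"
    by (intro measurable_PiM_single') auto
qed

lemma distr_bits_eqI:
  fixes f :: "'a \<Rightarrow> 'i \<Rightarrow> bool" and g :: "'b \<Rightarrow> 'i \<Rightarrow> bool"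
  assumes P: "prob_space P" and Q: "prob_space Q"
    and f: "f \<in> P \<rightarrow>\<^sub>M bits" and g: "g \<in> Q \<rightarrow>\<^sub>M bits"
    and eq: "\<And>J A. finite J \<Longrightarrow>
      emeasure P {x \<in> space P. \<forall>j\<in>J. f x j \<in> A j} = emeasure Q {x \<in> space Q. \<forall>j\<in>J. g x j \<in> A j}"
  shows "distr P bits f = distr Q bits g"
proof (rule measure_eqI_PiM_infinite)
  fix A :: "'i \<Rightarrow> bool set" and J :: "'i set"
  assume J: "finite J"
  let ?E = "prod_emb UNIV (\<lambda>_. count_space UNIV) J (Pi\<^sub>E J A)"
  have E: "?E \<in> sets bits"
    using J by (intro sets_PiM_I) auto
  have "f -` ?E \<inter> space P = {x \<in> space P. \<forall>j\<in>J. f x j \<in> A j}"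
    "g -` ?E \<inter> space Q = {x \<in> space Q. \<forall>j\<in>J. g x j \<in> A j}"
    by (auto simp: prod_emb_def)
  then show "emeasure (distr P bits f) ?E = emeasure (distr Q bits g) ?E"
    using eq[OF J] E f g by (simp add: emeasure_distr)
next
  show "finite_measure (distr P bits f)"
    using prob_space.prob_space_distr[OF P f] by (simp add: prob_space_def)
qed simp_all

text \<open>Coordinates outside \<open>L\<close> become \<open>False\<close> instead of being
  dropped, so that all partial stages of the sampling take values in the same space
  \<open>bits\<close>.\<close>

definition trunc :: "'i set \<Rightarrow> ('i \<Rightarrow> bool) \<Rightarrow> 'i \<Rightarrow> bool" where
  "trunc L t = (\<lambda>j. if j \<in> L then t j else False)"

lemma measurable_trunc [measurable]: "trunc L \<in> bits \<rightarrow>\<^sub>M bits"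
  unfolding measurable_to_bits trunc_def by auto

lemma trunc_UNIV [simp]: "trunc UNIV t = t"
  by (auto simp: trunc_def)

text \<open>\<open>p\<close> is a Radon-Nikodym density with respect to the law of
  \<open>trunc L\<close>: the conditional probability that bit \<open>i\<close> is true, given the
  bits in \<open>L\<close>. It has to lie in [0,1] everywhere, not just almost everywhere, because
  it serves as the bias of a coin.\<close>

lemma conditional_probability_bits:
  fixes m :: "('i \<Rightarrow> bool) measure"
  assumes m: "prob_space m" and sets_m: "sets m = sets bits"
  obtains p :: "('i \<Rightarrow> bool) \<Rightarrow> real" where "p \<in> borel_measurable bits"
    "\<And>t. 0 \<le> p t" "\<And>t. p t \<le> 1"
    "\<And>C. C \<in> sets bits \<Longrightarrow>
      emeasure m {t. trunc L t \<in> C \<and> t i} = (\<integral>\<^sup>+u. ennreal (p u) * indicator C u \<partial>distr m bits (trunc L))"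
proof -
  interpret prob_space m by fact
  have sp: "space m = UNIV"
    using sets_eq_imp_space_eq[OF sets_m] by simp
  note [measurable_cong] = sets_m
  define N where "N = distr m bits (trunc L)"
  define \<kappa> where "\<kappa> = distr (density m (indicator {t. t i})) bits (trunc L)"
  interpret N: prob_space N
    unfolding N_def by (intro prob_space_distr) measurable
  have comp [measurable]: "(\<lambda>t. t i) \<in> bits \<rightarrow>\<^sub>M count_space UNIV"
    by simp
  have [measurable]: "{t. t i} \<in> sets m"
    using measurable_sets[OF comp, of "{True}"] by (simp add: sets_m vimage_def)
  have em\<kappa>: "emeasure \<kappa> C = emeasure m {t. trunc L t \<in> C \<and> t i}" if [measurable]: "C \<in> sets bits" for C
  proof -
    have "emeasure \<kappa> C = emeasure (density m (indicator {t. t i})) (trunc L -` C \<inter> space m)"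
      unfolding \<kappa>_def by (subst emeasure_distr) (auto simp: sp)
    also have "\<dots> = emeasure m ({t. t i} \<inter> (trunc L -` C \<inter> space m))"
      by (subst emeasure_density) (auto simp: sp indicator_inter_arith[symmetric] intro!: measurable_sets_borel measurable_sets[OF measurable_trunc, of C, simplified] simp: sets_m)
    finally show ?thesis by (simp add: sp vimage_def Int_def conj_commute)
  qed
  have emN: "emeasure N C = emeasure m {t. trunc L t \<in> C}" if [measurable]: "C \<in> sets bits" for C
    unfolding N_def using that by (subst emeasure_distr) (auto simp: sp vimage_def)
  have le: "emeasure \<kappa> C \<le> emeasure N C" if C: "C \<in> sets bits" for C
    unfolding em\<kappa>[OF C] emN[OF C]
  proof (rule emeasure_mono)
    show "{t. trunc L t \<in> C} \<in> sets m"
      using measurable_sets[OF measurable_trunc C, of L] by (simp add: sets_m vimage_def)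
  qed auto
  have ac: "absolutely_continuous N \<kappa>"
    unfolding absolutely_continuous_def null_sets_def using le
    by (auto simp: N_def \<kappa>_def) (metis N_def \<kappa>_def le_zero_eq sets_distr)
  then obtain f where f [measurable]: "f \<in> borel_measurable N" and f\<kappa>: "density N f = \<kappa>"
    using N.Radon_Nikodym[of \<kappa>] by (auto simp: \<kappa>_def N_def)
  have sN: "sets N = sets bits" by (simp add: N_def)
  note [measurable_cong] = sN
  \<comment> \<open>Otherwise integrating \<open>f\<close> over the set where it exceeds 1 would
    give more than the measure of that set, against \<open>le\<close>.\<close>
  have f1: "AE u in N. f u \<le> 1"
  proof -
    define A where "A = {u \<in> space N. 1 < f u}"
    have A: "A \<in> sets N" unfolding A_def by measurable
    have "(\<integral>\<^sup>+u. f u * indicator A u \<partial>N) = emeasure \<kappa> A"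
      unfolding f\<kappa>[symmetric] using A f by (subst emeasure_density) auto
    also have "\<dots> \<le> emeasure N A" using A by (intro le) (simp add: sN)
    also have "\<dots> = (\<integral>\<^sup>+u. indicator A u \<partial>N)" using A by simp
    finally have *: "(\<integral>\<^sup>+u. f u * indicator A u \<partial>N) \<le> (\<integral>\<^sup>+u. indicator A u \<partial>N)" .
    have "AE u in N. f u * indicator A u \<le> indicator A u"
    proof (rule ccontr)
      assume n: "\<not> ?thesis"
      have "(\<integral>\<^sup>+u. indicator A u \<partial>N) < (\<integral>\<^sup>+u. f u * indicator A u \<partial>N)"
      proof (rule nn_integral_less)
        show "(\<integral>\<^sup>+u. indicator A u \<partial>N) \<noteq> \<infinity>" using A by simp
        show "AE u in N. indicator A u \<le> f u * indicator A u"
          by (intro AE_I2) (auto simp: indicator_def A_def)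
      qed (use n A f in auto)
      with * show False by simp
    qed
    then show ?thesis
    proof (rule AE_mp, intro AE_I2 impI)
      fix u assume u: "u \<in> space N" "f u * indicator A u \<le> indicator A u"
      show "f u \<le> 1"
      proof (rule ccontr)
        assume "\<not> f u \<le> 1"
        then have "u \<in> A" using u by (simp add: A_def)
        with u \<open>\<not> f u \<le> 1\<close> show False by simp
      qed
    qed
  qed
  \<comment> \<open>By \<open>f1\<close>, the cut at 1 changes \<open>f\<close> only on a null
    set.\<close>
  define p where "p u = enn2real (min 1 (f u))" for u
  show thesis
  proof
    show "p \<in> borel_measurable bits" unfolding p_def by measurable
    show "0 \<le> p t" for t by (simp add: p_def)
    show "p t \<le> 1" for t unfolding p_def
      using enn2real_mono[of "min 1 (f t)" 1] by simp
    fix C :: "('i \<Rightarrow> bool) set" assume C: "C \<in> sets bits"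
    have "emeasure m {t. trunc L t \<in> C \<and> t i} = (\<integral>\<^sup>+u. f u * indicator C u \<partial>N)"
      unfolding em\<kappa>[OF C, symmetric] f\<kappa>[symmetric] using C by (subst emeasure_density) (auto simp: sN)
    also have "\<dots> = (\<integral>\<^sup>+u. ennreal (p u) * indicator C u \<partial>N)"
    proof (rule nn_integral_cong_AE)
      show "AE u in N. f u * indicator C u = ennreal (p u) * indicator C u"
        using f1
      proof (rule AE_mp, intro AE_I2 impI)
        fix u assume "f u \<le> 1"
        then have "min 1 (f u) = f u" "f u < top"
          using le_less_trans[OF _ ennreal_one_less_top] by (auto simp: min_def)
        then show "f u * indicator C u = ennreal (p u) * indicator C u" by (simp add: p_def)
      qed
    qed
    finally show "emeasure m {t. trunc L t \<in> C \<and> t i} = (\<integral>\<^sup>+u. ennreal (p u) * indicator C u \<partial>distr m bits (trunc L))"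
      by (simp add: N_def)
  qed
qed

text \<open>Fubini with coordinate \<open>k\<close> innermost, so that whatever depends on the other
  coordinates acts as a constant.\<close>

lemma nn_integral_PiM_split:
  assumes S: "prob_space S" and f: "f \<in> borel_measurable (PiM UNIV (\<lambda>_. S))"
  shows "(\<integral>\<^sup>+r. f r \<partial>PiM UNIV (\<lambda>_. S)) =
    (\<integral>\<^sup>+X. \<integral>\<^sup>+x. f (X(k := x)) \<partial>S \<partial>PiM (UNIV - {k}) (\<lambda>_. S))"
proof -
  let ?R' = "PiM (UNIV - {k}) (\<lambda>_. S)"
  interpret S: prob_space S by fact
  interpret R': prob_space ?R' by (intro prob_space_PiM S)
  interpret pair_sigma_finite S ?R' by unfold_locales
  have ins: "insert k (UNIV - {k}) = UNIV" by auto
  have meas [measurable]: "(\<lambda>(x, X). X(k := x)) \<in> S \<Otimes>\<^sub>M ?R' \<rightarrow>\<^sub>M PiM UNIV (\<lambda>_. S)"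
  proof (rule measurable_PiM_single')
    fix i show "(\<lambda>\<omega>. (case \<omega> of (x, X) \<Rightarrow> X(k := x)) i) \<in> S \<Otimes>\<^sub>M ?R' \<rightarrow>\<^sub>M S"
      by (cases "i = k") (auto simp: case_prod_beta)
  next
    show "(\<lambda>(x, X). X(k := x)) \<in> space (S \<Otimes>\<^sub>M ?R') \<rightarrow> (\<Pi>\<^sub>E i\<in>UNIV. space S)"
    proof (rule funcsetI, clarify)
      fix x X assume "(x, X) \<in> space (S \<Otimes>\<^sub>M ?R')"
      then have "x \<in> space S" "\<And>i. i \<noteq> k \<Longrightarrow> X i \<in> space S"
        by (auto simp: space_pair_measure space_PiM)
      then show "X(k := x) \<in> (\<Pi>\<^sub>E i\<in>UNIV. space S)" by (simp add: PiE_iff)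
    qed
  qed
  have "PiM UNIV (\<lambda>_. S) = distr (S \<Otimes>\<^sub>M ?R') (PiM UNIV (\<lambda>_. S)) (\<lambda>(x, X). X(k := x))"
    using distr_pair_PiM_eq_PiM[of "UNIV - {k}" "\<lambda>_. S" k] S by (simp add: ins)
  then have "(\<integral>\<^sup>+r. f r \<partial>PiM UNIV (\<lambda>_. S)) = (\<integral>\<^sup>+z. f ((\<lambda>(x, X). X(k := x)) z) \<partial>(S \<Otimes>\<^sub>M ?R'))"
    using f meas by (metis nn_integral_distr)
  also have "\<dots> = (\<integral>\<^sup>+X. \<integral>\<^sup>+x. f ((\<lambda>(x, X). X(k := x)) (x, X)) \<partial>S \<partial>?R')"
    using measurable_compose[OF meas f] by (intro nn_integral_snd[symmetric])
  finally show ?thesis by simp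
qed

text \<open>
  Coordinates are produced one at a time along a well-ordering: given the coordinates before \<open>i\<close>,
  coordinate \<open>i\<close> is drawn with its conditional probability.
\<close>
theorem exists_sampling_map:
  fixes m :: "('i \<Rightarrow> bool) measure" and S :: "'s measure" and Q :: "real \<Rightarrow> 's \<Rightarrow> bool"
  assumes m: "prob_space m" and sets_m: "sets m = sets bits" and S: "prob_space S"
    and Q [measurable]: "(\<lambda>(p, b). Q p b) \<in> borel \<Otimes>\<^sub>M S \<rightarrow>\<^sub>M count_space UNIV"
    and Qp: "\<And>p. 0 \<le> p \<Longrightarrow> p \<le> 1 \<Longrightarrow> emeasure S {b \<in> space S. Q p b} = ennreal p"
  obtains g where "g \<in> PiM UNIV (\<lambda>_::'i. S) \<rightarrow>\<^sub>M bits" "distr (PiM UNIV (\<lambda>_. S)) bits g = m"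
proof -
  define R where "R = PiM UNIV (\<lambda>_::'i. S)"
  interpret m: prob_space m by fact
  interpret S: prob_space S by fact
  interpret R: prob_space R unfolding R_def by (intro prob_space_PiM S)
  have sp: "space m = UNIV"
    using sets_eq_imp_space_eq[OF sets_m] by simp
  note [measurable_cong] = sets_m
  have spR: "r \<in> space R \<Longrightarrow> r i \<in> space S" for r i
    by (auto simp: R_def space_PiM)
  obtain ro :: "'i rel" where ro: "Well_order ro" "Field ro = UNIV"
    using well_ordering by metis
  define lt where "lt = ro - Id"
  have wf: "wf lt" using ro by (auto simp: lt_def well_order_on_def)
  have tot: "(i, j) \<in> lt \<or> i = j \<or> (j, i) \<in> lt" for i j
    using ro by (auto simp: lt_def well_order_on_def linear_order_on_def total_on_def)
  have trans: "(i, j) \<in> lt \<Longrightarrow> (j, k) \<in> lt \<Longrightarrow> (i, k) \<in> lt" for i j k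
    using ro unfolding lt_def well_order_on_def linear_order_on_def partial_order_on_def
      preorder_on_def antisym_def trans_def by blast
  define L where "L k = {j. (j, k) \<in> lt}" for k
  define L' where "L' k = insert k (L k)" for k
  have "\<forall>k. \<exists>p. p \<in> borel_measurable bits \<and> (\<forall>t. 0 \<le> p t) \<and> (\<forall>t. p t \<le> 1) \<and>
      (\<forall>C \<in> sets bits. emeasure m {t. trunc (L k) t \<in> C \<and> t k} =
        (\<integral>\<^sup>+u. ennreal (p u) * indicator C u \<partial>distr m bits (trunc (L k))))"
    by (rule allI, rule conditional_probability_bits[OF m sets_m]) blast
  from choice[OF this] obtain p :: "'i \<Rightarrow> ('i \<Rightarrow> bool) \<Rightarrow> real"
    where p_all: "\<forall>k. p k \<in> borel_measurable bits \<and> (\<forall>t. 0 \<le> p k t) \<and> (\<forall>t. p k t \<le> 1) \<and>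
      (\<forall>C \<in> sets bits. emeasure m {t. trunc (L k) t \<in> C \<and> t k} =
        (\<integral>\<^sup>+u. ennreal (p k u) * indicator C u \<partial>distr m bits (trunc (L k))))" ..
  have p_meas: "p k \<in> borel_measurable bits" and p0: "0 \<le> p k t" and p1: "p k t \<le> 1" for k t
    using p_all by auto
  have p: "C \<in> sets bits \<Longrightarrow> emeasure m {t. trunc (L k) t \<in> C \<and> t k} =
      (\<integral>\<^sup>+u. ennreal (p k u) * indicator C u \<partial>distr m bits (trunc (L k)))" for k C
    using p_all by blast
  \<comment> \<open>\<open>r i\<close> is the private randomness of coordinate \<open>i\<close>, and
    \<open>p i\<close> reads the coordinates drawn before it.\<close>
  define G where "G r = wfrec lt (\<lambda>F i. Q (p i (trunc (L i) F)) (r i))" for r :: "'i \<Rightarrow> 's"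
  have G: "G r i = Q (p i (trunc (L i) (G r))) (r i)" for r i
  proof -
    have "trunc (L i) (cut (G r) lt i) = trunc (L i) (G r)"
      by (auto simp: trunc_def L_def cut_def)
    then show ?thesis
      unfolding G_def by (subst wfrec[OF wf]) simp
  qed
  have G_meas1: "(\<lambda>r. G r i) \<in> R \<rightarrow>\<^sub>M count_space UNIV" for i
    using wf
  proof (induction i rule: wf_induct_rule)
    case (less i)
    have [measurable]: "(\<lambda>r. r i) \<in> R \<rightarrow>\<^sub>M S" by (simp add: R_def)
    have [measurable]: "(\<lambda>r. trunc (L i) (G r)) \<in> R \<rightarrow>\<^sub>M bits"
      unfolding measurable_to_bits trunc_def using less by (auto simp: L_def)
    note [measurable] = p_meas
    have "(\<lambda>r. (\<lambda>(p, b). Q p b) (p i (trunc (L i) (G r)), r i)) \<in> R \<rightarrow>\<^sub>M count_space UNIV"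
      by (intro measurable_compose[OF _ Q] measurable_Pair) measurable
    then show ?case by (subst G) simp
  qed
  then have G_meas [measurable]: "G \<in> R \<rightarrow>\<^sub>M bits"
    by (simp add: measurable_to_bits)
  \<comment> \<open>Coordinates before \<open>k\<close> do not read \<open>r k\<close>, so
    \<open>r k\<close> is independent of them. This is what allows \<open>step\<close> to integrate
    it separately.\<close>
  have G_upd: "(i, k) \<in> lt \<Longrightarrow> G (r(k := x)) i = G r i" for r k x i
    using wf
  proof (induction i rule: wf_induct_rule)
    case (less i)
    have "trunc (L i) (G (r(k := x))) = trunc (L i) (G r)"
      using less trans by (fastforce simp: trunc_def L_def)
    moreover have "i \<noteq> k" using less.prems by (auto simp: lt_def)
    ultimately show ?case by (subst (1 2) G) simp
  qed
  have max_ex: "\<exists>k\<in>F. \<forall>j\<in>F. j \<in> L' k" if "finite F" "F \<noteq> {}" for F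
    using that
  proof (induction F rule: finite_ne_induct)
    case (singleton x)
    then show ?case by (auto simp: L'_def)
  next
    case (insert x F)
    then obtain k where k: "k \<in> F" "\<forall>j\<in>F. j \<in> L' k" by blast
    show ?case
    proof (cases "(k, x) \<in> lt")
      case True
      then have "\<forall>j\<in>insert x F. j \<in> L' x" using k trans by (auto simp: L'_def L_def)
      then show ?thesis by blast
    next
      case False
      then have "\<forall>j\<in>insert x F. j \<in> L' k" using k tot[of k x] by (auto simp: L'_def L_def)
      then show ?thesis using k by blast
    qed
  qed
  have step: "emeasure R {r \<in> space R. trunc (L k) (G r) \<in> C \<and> G r k} = emeasure m {t. trunc (L k) t \<in> C \<and> t k}"
    if eq: "distr R bits (\<lambda>r. trunc (L k) (G r)) = distr m bits (trunc (L k))" and C: "C \<in> sets bits" for k C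
  proof -
    define T where "T r = trunc (L k) (G r)" for r
    have T_upd: "T (X(k := x)) = T X" for X x
      using G_upd by (auto simp: T_def trunc_def L_def)
    have T_meas [measurable]: "T \<in> R \<rightarrow>\<^sub>M bits" unfolding T_def by measurable
    note [measurable] = G_meas1 p_meas C
    have E [measurable]: "{r \<in> space R. T r \<in> C \<and> G r k} \<in> sets R"
      by measurable
    let ?R' = "PiM (UNIV - {k}) (\<lambda>_. S)"
    have "emeasure R {r \<in> space R. T r \<in> C \<and> G r k} = (\<integral>\<^sup>+r. indicator {r \<in> space R. T r \<in> C \<and> G r k} r \<partial>R)"
      by simp
    also have "\<dots> = (\<integral>\<^sup>+X. \<integral>\<^sup>+x. indicator {r \<in> space R. T r \<in> C \<and> G r k} (X(k := x)) \<partial>S \<partial>?R')"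
      unfolding R_def by (rule nn_integral_PiM_split[OF S]) (use E in \<open>simp add: R_def\<close>)
    also have "\<dots> = (\<integral>\<^sup>+X. \<integral>\<^sup>+x. ennreal (p k (T (X(k := x)))) * indicator C (T (X(k := x))) \<partial>S \<partial>?R')"
    proof (rule nn_integral_cong)
      fix X assume X: "X \<in> space ?R'"
      have "(\<integral>\<^sup>+x. indicator {r \<in> space R. T r \<in> C \<and> G r k} (X(k := x)) \<partial>S) =
          (\<integral>\<^sup>+x. indicator C (T X) * indicator {b \<in> space S. Q (p k (T X)) b} x \<partial>S)"
      proof (rule nn_integral_cong)
        fix x assume x: "x \<in> space S"
        have "X(k := x) \<in> space R" using X x by (simp add: R_def space_PiM PiE_iff)
        moreover have "G (X(k := x)) k \<longleftrightarrow> Q (p k (T X)) x"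
          using G[of "X(k := x)" k] T_upd[of X x] by (simp add: T_def)
        ultimately show "indicator {r \<in> space R. T r \<in> C \<and> G r k} (X(k := x)) =
            (indicator C (T X) * indicator {b \<in> space S. Q (p k (T X)) b} x :: ennreal)"
          using x by (auto simp: indicator_def T_upd)
      qed
      also have "\<dots> = indicator C (T X) * emeasure S {b \<in> space S. Q (p k (T X)) b}"
        by (subst nn_integral_cmult) simp_all
      also have "\<dots> = ennreal (p k (T X)) * indicator C (T X)"
        by (simp add: Qp p0 p1 mult.commute)
      finally show "(\<integral>\<^sup>+x. indicator {r \<in> space R. T r \<in> C \<and> G r k} (X(k := x)) \<partial>S) =
          (\<integral>\<^sup>+x. ennreal (p k (T (X(k := x)))) * indicator C (T (X(k := x))) \<partial>S)"
        by (simp add: T_upd S.emeasure_space_1)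
    qed
    also have "\<dots> = (\<integral>\<^sup>+r. ennreal (p k (T r)) * indicator C (T r) \<partial>R)"
      unfolding R_def by (rule nn_integral_PiM_split[OF S, symmetric]) (simp add: R_def[symmetric])
    also have "\<dots> = (\<integral>\<^sup>+u. ennreal (p k u) * indicator C u \<partial>distr R bits T)"
      by (subst nn_integral_distr) auto
    also have "\<dots> = emeasure m {t. trunc (L k) t \<in> C \<and> t k}"
      unfolding T_def eq p[OF C] ..
    finally show ?thesis by (simp add: T_def)
  qed
  \<comment> \<open>Passage through limits: a cylinder inspects finitely many coordinates, and those
    in \<open>D\<close> all lie in \<open>L' k\<close> for the last of them, so agreement of the
    laws on the segments \<open>L' k\<close> passes to their union. Coordinates outside
    \<open>D\<close> are constantly \<open>False\<close> on both sides.\<close>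
  have ext: "distr R bits (\<lambda>r. trunc D (G r)) = distr m bits (trunc D)"
    if D: "\<And>k. k \<in> D \<Longrightarrow> L' k \<subseteq> D \<and> distr R bits (\<lambda>r. trunc (L' k) (G r)) = distr m bits (trunc (L' k))" for D
  proof (rule distr_bits_eqI)
    fix J :: "'i set" and A :: "'i \<Rightarrow> bool set" assume J: "finite J"
    show "emeasure R {r \<in> space R. \<forall>j\<in>J. trunc D (G r) j \<in> A j} =
        emeasure m {t \<in> space m. \<forall>j\<in>J. trunc D t j \<in> A j}"
    proof (cases "J \<inter> D = {}")
      case True
      then have "trunc D t j = False" if "j \<in> J" for j t using that by (auto simp: trunc_def)
      then have "{r \<in> space R. \<forall>j\<in>J. trunc D (G r) j \<in> A j} = (if \<forall>j\<in>J. False \<in> A j then space R else {})"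
        "{t \<in> space m. \<forall>j\<in>J. trunc D t j \<in> A j} = (if \<forall>j\<in>J. False \<in> A j then space m else {})"
        by auto
      then show ?thesis
        using R.emeasure_space_1 m.emeasure_space_1 by simp
    next
      case False
      have "\<exists>k\<in>J \<inter> D. \<forall>j\<in>J \<inter> D. j \<in> L' k"
        using max_ex False J by simp
      then obtain k where k: "k \<in> D" "\<forall>j\<in>J \<inter> D. j \<in> L' k" by blast
      have tr: "trunc D t j = trunc (L' k) t j" if "j \<in> J" for t j
        using k D[OF k(1)] that by (auto simp: trunc_def)
      let ?E = "{u. \<forall>j\<in>J. u j \<in> A j}"
      have E: "?E \<in> sets bits"
      proof -
        have "?E = prod_emb UNIV (\<lambda>_. count_space UNIV) J (Pi\<^sub>E J A)"
          by (auto simp: prod_emb_def)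
        then show ?thesis using J by (auto intro!: sets_PiM_I)
      qed
      have "emeasure R {r \<in> space R. \<forall>j\<in>J. trunc D (G r) j \<in> A j} = emeasure (distr R bits (\<lambda>r. trunc (L' k) (G r))) ?E"
        by (subst emeasure_distr) (auto simp: E tr intro!: arg_cong[where f="emeasure R"])
      also have "\<dots> = emeasure (distr m bits (trunc (L' k))) ?E"
        using D[OF k(1)] by simp
      also have "\<dots> = emeasure m {t \<in> space m. \<forall>j\<in>J. trunc D t j \<in> A j}"
        by (subst emeasure_distr) (auto simp: E tr intro!: arg_cong[where f="emeasure m"])
      finally show ?thesis .
    qed
  qed (use m R.prob_space_axioms in measurable)
  have "distr R bits (\<lambda>r. trunc (L' k) (G r)) = distr m bits (trunc (L' k))" for k
    using wf
  proof (induction k rule: wf_induct_rule)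
    case (less k)
    have eq: "distr R bits (\<lambda>r. trunc (L k) (G r)) = distr m bits (trunc (L k))"
      by (rule ext) (use less trans in \<open>auto simp: L_def L'_def\<close>)
    show ?case
    proof (rule measure_eqI)
      fix D assume "D \<in> sets (distr R bits (\<lambda>r. trunc (L' k) (G r)))"
      then have D [measurable]: "D \<in> sets bits" by simp
      \<comment> \<open>Sections of \<open>D\<close> by the value of coordinate \<open>k\<close>.
        Since \<open>step\<close> computes only events with bit \<open>k\<close> true, the section
        at \<open>False\<close> enters below through a difference.\<close>
      define E where "E b = {u. u(k := b) \<in> D}" for b
      have E [measurable]: "E b \<in> sets bits" for b
      proof -
        have "(\<lambda>u. u(k := b)) \<in> bits \<rightarrow>\<^sub>M (bits :: ('i \<Rightarrow> bool) measure)"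
          unfolding measurable_to_bits by auto
        from measurable_sets[OF this D] show ?thesis by (simp add: E_def vimage_def)
      qed
      have tr: "trunc (L' k) t = (trunc (L k) t)(k := t k)" for t
        by (auto simp: trunc_def L'_def L_def lt_def)
      have m_E [measurable]: "{t. trunc (L k) t \<in> E b \<and> t k} \<in> sets m" for b
      proof -
        have "{t \<in> space m. trunc (L k) t \<in> E b \<and> t k} \<in> sets m" by measurable
        then show ?thesis by (simp add: sp)
      qed
      have m_E' [measurable]: "{t. trunc (L k) t \<in> E b} \<in> sets m" for b
      proof -
        have "{t \<in> space m. trunc (L k) t \<in> E b} \<in> sets m" by measurable
        then show ?thesis by (simp add: sp)
      qed
      note [measurable] = G_meas1
      have [measurable]: "{r \<in> space R. trunc (L k) (G r) \<in> E b \<and> G r k} \<in> sets R"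
        "{r \<in> space R. trunc (L k) (G r) \<in> E b} \<in> sets R" for b
        by measurable
      have eqE: "emeasure R {r \<in> space R. trunc (L k) (G r) \<in> E b} = emeasure m {t. trunc (L k) t \<in> E b}" for b
      proof -
        have "emeasure R {r \<in> space R. trunc (L k) (G r) \<in> E b} = emeasure (distr R bits (\<lambda>r. trunc (L k) (G r))) (E b)"
          by (subst emeasure_distr) (auto intro!: arg_cong[where f="emeasure R"])
        also have "\<dots> = emeasure m {t. trunc (L k) t \<in> E b}"
          unfolding eq by (subst emeasure_distr) (auto simp: sp vimage_def)
        finally show ?thesis .
      qed
      let ?RT = "{r \<in> space R. trunc (L k) (G r) \<in> E True \<and> G r k}"
      let ?RF = "{r \<in> space R. trunc (L k) (G r) \<in> E False}"
      let ?RFT = "{r \<in> space R. trunc (L k) (G r) \<in> E False \<and> G r k}"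
      let ?mT = "{t. trunc (L k) t \<in> E True \<and> t k}"
      let ?mF = "{t. trunc (L k) t \<in> E False}"
      let ?mFT = "{t. trunc (L k) t \<in> E False \<and> t k}"
      have D_iff: "v(k := b) \<in> D \<longleftrightarrow> v \<in> E True \<and> b \<or> v \<in> E False \<and> \<not> b" for v b
        by (cases b) (auto simp: E_def)
      have "emeasure (distr R bits (\<lambda>r. trunc (L' k) (G r))) D =
          emeasure R ((\<lambda>r. trunc (L' k) (G r)) -` D \<inter> space R)"
        by (intro emeasure_distr measurable_compose[OF G_meas measurable_trunc] D)
      also have "(\<lambda>r. trunc (L' k) (G r)) -` D \<inter> space R = ?RT \<union> (?RF - ?RFT)"
        by (auto simp: tr D_iff)
      also have "emeasure R \<dots> = emeasure R ?RT + emeasure R (?RF - ?RFT)"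
        by (intro plus_emeasure[symmetric]) auto
      also have "\<dots> = emeasure R ?RT + (emeasure R ?RF - emeasure R ?RFT)"
        by (subst emeasure_Diff) auto
      also have "\<dots> = emeasure m ?mT + (emeasure m ?mF - emeasure m ?mFT)"
        by (simp add: step[OF eq E] eqE)
      also have "\<dots> = emeasure m ?mT + emeasure m (?mF - ?mFT)"
        by (subst emeasure_Diff) auto
      also have "\<dots> = emeasure m (?mT \<union> (?mF - ?mFT))"
        by (intro plus_emeasure) auto
      also have "?mT \<union> (?mF - ?mFT) = trunc (L' k) -` D \<inter> space m"
        by (auto simp: tr D_iff sp)
      also have "emeasure m \<dots> = emeasure (distr m bits (trunc (L' k))) D"
        by (rule emeasure_distr[symmetric]) measurable
      finally show "emeasure (distr R bits (\<lambda>r. trunc (L' k) (G r))) D = emeasure (distr m bits (trunc (L' k))) D" .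
    qed simp
  qed
  then have "distr R bits (\<lambda>r. trunc UNIV (G r)) = distr m bits (trunc UNIV)"
    by (intro ext) auto
  then have "distr R bits G = distr m bits (\<lambda>t. t)"
    by (simp cong: distr_cong)
  then have "distr R bits G = m"
    by (simp add: distr_id2[OF sets_m[symmetric]])
  then show thesis
    using that[of G] G_meas by (simp add: R_def)
qed

subsection \<open>Independent samples from fair coins\<close>

abbreviation coin :: "bool measure" where
  "coin \<equiv> uniform_count_measure UNIV"

lemma prob_space_coin: "prob_space coin"
  by (intro prob_space_uniform_count_measure) auto

lemma sets_coin [simp, measurable_cong]: "sets coin = sets (count_space UNIV)"
  by (simp add: sets_uniform_count_measure)

lemma emeasure_coin: "emeasure coin {b} = ennreal (1/2)"
  by (subst emeasure_uniform_count_measure) auto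

lemma prob_space_cube: "prob_space (cube_measure I)"
  unfolding cube_measure_def by (intro prob_space_PiM prob_space_coin)

lemma sets_cube [measurable_cong]: "sets (cube_measure UNIV) = sets bits"
  unfolding cube_measure_def by (intro sets_PiM_cong) auto

lemma space_cube [simp]: "space (cube_measure UNIV) = UNIV"
  using sets_eq_imp_space_eq[OF sets_cube] by simp

text \<open>The clause \<open>p \<ge> 1\<close> gives 1 the expansion 0.111...; parity of the floor
  alone would give only zeros there.\<close>

definition binary_digit :: "nat \<Rightarrow> real \<Rightarrow> bool" where
  "binary_digit n p \<longleftrightarrow> p \<ge> 1 \<or> odd \<lfloor>p * 2 ^ Suc n\<rfloor>"

text \<open>The position of the first \<open>True\<close> is geometric, so this reads digit \<open>n\<close> of \<open>p\<close> with probability \<open>2\<^bsup>-n-1\<^esup>\<close>.\<close>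
definition digit_at_first_True :: "real \<Rightarrow> (nat \<Rightarrow> bool) \<Rightarrow> bool" where
  "digit_at_first_True p b \<longleftrightarrow> (\<exists>n. b n \<and> (\<forall>i<n. \<not> b i) \<and> binary_digit n p)"

text \<open>The partial sums are the dyadic truncations
  \<open>\<lfloor>p * 2 ^ N\<rfloor> / 2 ^ N\<close>: each floor is twice the previous one plus the
  new digit.\<close>

lemma binary_digits_sum:
  assumes "0 \<le> p" "p \<le> 1"
  shows "(\<lambda>n. of_bool (binary_digit n p) * (1/2) ^ Suc n) sums p"
proof (cases "p = 1")
  case True
  then show ?thesis using power_half_series by (simp add: binary_digit_def)
next
  case False
  then have p: "0 \<le> p" "p < 1" using assms by auto
  have partial: "(\<Sum>n<N. of_bool (binary_digit n p) * (1/2 :: real) ^ Suc n) = of_int \<lfloor>p * 2 ^ N\<rfloor> / 2 ^ N" for N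
  proof (induction N)
    case 0
    have "\<lfloor>p\<rfloor> = 0" using p by (simp add: floor_eq_iff)
    then show ?case by simp
  next
    case (Suc N)
    let ?a = "\<lfloor>p * 2 ^ Suc N\<rfloor>"
    have "\<lfloor>p * 2 ^ N\<rfloor> = ?a div 2"
      using floor_divide_real_eq_div[of 2 "p * 2 ^ Suc N"] by simp
    then have "?a = 2 * \<lfloor>p * 2 ^ N\<rfloor> + of_bool (odd ?a)"
      by (simp add: of_bool_odd_eq_mod_2)
    moreover have "odd ?a \<longleftrightarrow> binary_digit N p"
      using p unfolding binary_digit_def by simp
    ultimately have "?a = 2 * \<lfloor>p * 2 ^ N\<rfloor> + of_bool (binary_digit N p)"
      by (simp only:)
    from arg_cong[OF this, of real_of_int]
    have a: "real_of_int ?a = 2 * of_int \<lfloor>p * 2 ^ N\<rfloor> + of_bool (binary_digit N p)"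
      by (simp only: of_int_add of_int_mult of_int_numeral of_int_of_bool)
    have "x / 2 ^ N + c * (1/2) ^ Suc N = (2 * x + c) / 2 ^ Suc N" for x c :: real
      by (simp add: power_one_over add_divide_distrib)
    then show ?case
      unfolding sum.lessThan_Suc Suc a .
  qed
  have "(\<lambda>N. of_int \<lfloor>p * 2 ^ N\<rfloor> / 2 ^ N) \<longlonglongrightarrow> p"
  proof (rule real_tendsto_sandwich)
    have "(\<lambda>N. p - (1/2) ^ N) \<longlonglongrightarrow> p - 0"
      by (intro tendsto_diff tendsto_const LIMSEQ_power_zero) auto
    then show "(\<lambda>N. p - (1/2) ^ N) \<longlonglongrightarrow> p" by simp
    have "p - (1/2) ^ N \<le> of_int \<lfloor>p * 2 ^ N\<rfloor> / 2 ^ N" for N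
      using real_of_int_floor_gt_diff_one[of "p * 2 ^ N"]
      by (simp add: power_one_over pos_le_divide_eq left_diff_distrib)
    then show "\<forall>\<^sub>F N in sequentially. p - (1/2) ^ N \<le> of_int \<lfloor>p * 2 ^ N\<rfloor> / 2 ^ N" by simp
    show "\<forall>\<^sub>F N in sequentially. of_int \<lfloor>p * 2 ^ N\<rfloor> / 2 ^ N \<le> p"
      by (simp add: field_simps)
  qed simp
  then show ?thesis unfolding sums_def partial .
qed

lemma measurable_digit_at_first_True [measurable]:
  "(\<lambda>(p, b). digit_at_first_True p b) \<in> borel \<Otimes>\<^sub>M cube_measure UNIV \<rightarrow>\<^sub>M count_space UNIV"
proof -
  have [measurable]: "(\<lambda>b. b n) \<in> cube_measure UNIV \<rightarrow>\<^sub>M count_space UNIV" for n :: nat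
    using measurable_component_singleton[of n UNIV "\<lambda>_. count_space (UNIV :: bool set)"]
    by (simp cong: measurable_cong_sets[OF sets_cube])
  show ?thesis
    unfolding digit_at_first_True_def binary_digit_def by measurable
qed

lemma emeasure_digit_at_first_True:
  assumes "0 \<le> p" "p \<le> 1"
  shows "emeasure (cube_measure UNIV) {b \<in> space (cube_measure UNIV). digit_at_first_True p b} = ennreal p"
proof -
  interpret P: product_prob_space "\<lambda>_. coin" "UNIV :: nat set"
    by (simp add: product_prob_space_def product_prob_space_axioms_def product_sigma_finite_def
        prob_space_coin prob_space_imp_sigma_finite)
  let ?C = "cube_measure (UNIV :: nat set)"
  define A where "A n = {b :: nat \<Rightarrow> bool. b n \<and> (\<forall>i<n. \<not> b i) \<and> binary_digit n p}" for n
  have cyl: "{b. b n \<and> (\<forall>i<n. \<not> b i)} = {x \<in> space (PiM UNIV (\<lambda>_. coin)). \<forall>i\<in>{..n}. x i \<in> {i = n}}" for n :: nat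
    by (auto simp: space_PiM le_less space_uniform_count_measure)
  have A_eq: "A n = (if binary_digit n p then {b. b n \<and> (\<forall>i<n. \<not> b i)} else {})" for n
    by (auto simp: A_def)
  have "emeasure (PiM UNIV (\<lambda>_. coin)) {b. b n \<and> (\<forall>i<n. \<not> b i)} = (\<Prod>i\<in>{..n}. emeasure coin {i = n})" for n :: nat
    unfolding cyl by (rule P.emeasure_PiM_Collect) auto
  then have em: "emeasure ?C {b. b n \<and> (\<forall>i<n. \<not> b i)} = ennreal ((1/2) ^ Suc n)" for n
    by (simp only: cube_measure_def emeasure_coin prod_constant card_atMost) (intro ennreal_power, simp)
  have sA: "A n \<in> sets ?C" for n
  proof -
    \<comment> \<open>Measurability comes for free: a nonmeasurable set would get measure 0, while
      \<open>em\<close> gives a positive value.\<close>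
    have "{b. b n \<and> (\<forall>i<n. \<not> b i)} \<in> sets ?C"
    proof (rule ccontr)
      assume "{b. b n \<and> (\<forall>i<n. \<not> b i)} \<notin> sets ?C"
      from emeasure_notin_sets[OF this] em[of n] show False by simp
    qed
    then show ?thesis by (simp add: A_eq)
  qed
  have emA: "emeasure ?C (A n) = ennreal (of_bool (binary_digit n p) * (1/2) ^ Suc n)" for n
    unfolding A_eq using em[of n] by simp
  have disj: "disjoint_family A"
    unfolding disjoint_family_on_def A_def by (auto, metis linorder_neqE_nat)
  have "{b \<in> space ?C. digit_at_first_True p b} = (\<Union>n. A n)"
    by (auto simp: digit_at_first_True_def A_def)
  then have "emeasure ?C {b \<in> space ?C. digit_at_first_True p b} = (\<Sum>n. emeasure ?C (A n))"
    using suminf_emeasure[of A ?C] sA disj by (simp add: image_subset_iff)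
  also have "\<dots> = ennreal p"
    unfolding emA using binary_digits_sum[OF assms]
    by (intro suminf_ennreal_eq) auto
  finally show ?thesis .
qed

section \<open>Reindexing coins and drawing independent sequences\<close>

lemma distr_cube_reindex:
  assumes "inj f" "range f \<subseteq> K"
  shows "distr (cube_measure K) (cube_measure UNIV) (\<lambda>\<omega> i. \<omega> (f i)) = cube_measure UNIV"
  using distr_PiM_reindex[of K "\<lambda>_. coin" f UNIV] assms prob_space_coin
  by (simp add: cube_measure_def restrict_UNIV image_subset_iff_funcset)

lemma measurable_cube_reindex:
  assumes "range f \<subseteq> K"
  shows "(\<lambda>\<omega> i. \<omega> (f i)) \<in> cube_measure K \<rightarrow>\<^sub>M cube_measure UNIV"
  unfolding cube_measure_def using assms
  by (intro measurable_PiM_single' measurable_component_singleton) (auto simp: space_PiM space_uniform_count_measure)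

text \<open>Distinct rows use disjoint blocks of independent coordinates.\<close>

lemma indep_vars_cube_rows:
  "prob_space.indep_vars (cube_measure UNIV) (\<lambda>_. cube_measure UNIV)
    (\<lambda>(j :: 'j) (\<omega> :: 'j \<times> 'k \<Rightarrow> bool) k. \<omega> (j, k)) UNIV"
proof -
  let ?C = "cube_measure (UNIV :: ('j \<times> 'k) set)"
  interpret prob_space ?C by (rule prob_space_cube)
  have rv: "(\<lambda>\<omega>. \<omega> i) \<in> ?C \<rightarrow>\<^sub>M coin" for i :: "'j \<times> 'k"
    unfolding cube_measure_def by simp
  have comp: "distr ?C coin (\<lambda>\<omega>. \<omega> i) = coin" for i :: "'j \<times> 'k"
    unfolding cube_measure_def by (rule distr_PiM_component) (auto intro: prob_space_coin)
  have "indep_vars (\<lambda>_. coin) (\<lambda>i \<omega>. \<omega> i) UNIV"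
    by (subst indep_vars_iff_distr_eq_PiM')
      (use rv in \<open>auto simp: comp restrict_UNIV distr_id2\<close>, simp add: cube_measure_def distr_id2)
  from indep_vars_restrict[OF this, of UNIV "\<lambda>j. {j} \<times> UNIV"]
  have "indep_vars (\<lambda>j. PiM ({j} \<times> UNIV) (\<lambda>_. coin)) (\<lambda>j \<omega>. restrict \<omega> ({j} \<times> UNIV)) (UNIV :: 'j set)"
    by (auto simp: disjoint_family_on_def)
  moreover have "(\<lambda>\<omega> k. \<omega> (j, k)) \<in> PiM ({j} \<times> UNIV) (\<lambda>_. coin) \<rightarrow>\<^sub>M cube_measure (UNIV :: 'k set)" for j :: 'j
    unfolding cube_measure_def
    by (intro measurable_PiM_single' measurable_component_singleton) (auto simp: space_PiM)
  ultimately have "indep_vars (\<lambda>_. cube_measure UNIV)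
      (\<lambda>(j :: 'j) \<omega> (k :: 'k). restrict \<omega> ({j} \<times> UNIV) (j, k)) UNIV"
    by (rule indep_vars_compose2)
  then show ?thesis by simp
qed

text \<open>In the index type \<open>nat \<times> 'i \<times> nat\<close>, the first component
  numbers the sample, the second the bit of that sample, and the third the coins spent on drawing
  that bit.\<close>

lemma exists_iid_sampling_map:
  fixes m :: "('i \<Rightarrow> bool) measure"
  assumes m: "prob_space m" and sets_m: "sets m = sets bits"
  obtains \<Gamma> where "\<Gamma> \<in> cube_measure (UNIV :: (nat \<times> 'i \<times> nat) set) \<rightarrow>\<^sub>M PiM UNIV (\<lambda>_ :: nat. m)"
    "distr (cube_measure UNIV) (PiM UNIV (\<lambda>_. m)) \<Gamma> = PiM UNIV (\<lambda>_. m)"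
proof -
  obtain g where g: "g \<in> PiM UNIV (\<lambda>_::'i. cube_measure (UNIV :: nat set)) \<rightarrow>\<^sub>M bits"
    and g_distr: "distr (PiM UNIV (\<lambda>_::'i. cube_measure (UNIV :: nat set))) bits g = m"
    using exists_sampling_map[OF m sets_m prob_space_cube measurable_digit_at_first_True emeasure_digit_at_first_True]
    by metis
  have rows: "(\<lambda>\<omega> k. \<omega> (j, k)) \<in> cube_measure UNIV \<rightarrow>\<^sub>M cube_measure (UNIV :: 'l set)" for j :: 'j
    by (rule measurable_cube_reindex) auto
  have distr_row: "distr (cube_measure UNIV) (cube_measure (UNIV :: 'l set)) (\<lambda>\<omega> k. \<omega> (j, k)) = cube_measure UNIV" for j :: 'j
    by (rule distr_cube_reindex) (auto intro: injI)
  let ?h = "\<lambda>(\<omega> :: 'i \<times> nat \<Rightarrow> bool) j k. \<omega> (j, k)"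
  let ?P = "PiM UNIV (\<lambda>_::'i. cube_measure (UNIV :: nat set))"
  have h: "?h \<in> cube_measure UNIV \<rightarrow>\<^sub>M ?P"
    by (intro measurable_PiM_single' rows) (auto simp: space_PiM)
  have h_distr: "distr (cube_measure UNIV) ?P ?h = ?P"
    using indep_vars_cube_rows[where 'j = 'i and 'k = nat] rows
    by (subst (asm) prob_space.indep_vars_iff_distr_eq_PiM'[OF prob_space_cube])
      (auto simp: restrict_UNIV distr_row)
  define \<gamma> where "\<gamma> = g \<circ> ?h"
  have \<gamma>: "\<gamma> \<in> cube_measure UNIV \<rightarrow>\<^sub>M m"
    unfolding \<gamma>_def using measurable_comp[OF h g] by (simp cong: measurable_cong_sets[OF refl sets_m])
  have \<gamma>_distr: "distr (cube_measure UNIV) m \<gamma> = m"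
    unfolding \<gamma>_def using distr_distr[OF g h] g_distr h_distr by (simp cong: distr_cong add: sets_m)
  define \<Gamma> where "\<Gamma> \<omega> n = \<gamma> (\<lambda>k. \<omega> (n, k))" for \<omega> :: "nat \<times> 'i \<times> nat \<Rightarrow> bool" and n
  have \<Gamma>n: "(\<lambda>\<omega>. \<Gamma> \<omega> n) \<in> cube_measure UNIV \<rightarrow>\<^sub>M m" for n
    unfolding \<Gamma>_def by (rule measurable_compose[OF rows \<gamma>])
  have \<Gamma>n_distr: "distr (cube_measure UNIV) m (\<lambda>\<omega>. \<Gamma> \<omega> n) = m" for n
    using distr_distr[OF \<gamma> rows[of n]] by (simp add: \<Gamma>_def[abs_def] comp_def distr_row \<gamma>_distr)
  have "prob_space.indep_vars (cube_measure UNIV) (\<lambda>_. m) (\<lambda>n \<omega>. \<Gamma> \<omega> n) UNIV"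
    unfolding \<Gamma>_def
    by (rule prob_space.indep_vars_compose2[OF prob_space_cube indep_vars_cube_rows \<gamma>])
  then have "distr (cube_measure UNIV) (PiM UNIV (\<lambda>_. m)) \<Gamma> = PiM UNIV (\<lambda>_. m)"
    by (subst (asm) prob_space.indep_vars_iff_distr_eq_PiM'[OF prob_space_cube])
      (auto simp: \<Gamma>n restrict_UNIV \<Gamma>n_distr)
  moreover have "\<Gamma> \<in> cube_measure UNIV \<rightarrow>\<^sub>M PiM UNIV (\<lambda>_. m)"
    using \<Gamma>n measurable_space[OF \<Gamma>n] by (intro measurable_PiM_single') auto
  ultimately show thesis using that by blast
qed

text \<open>The first \<open>N\<close> samples all miss \<open>B\<close> with probability
  \<open>(1 - measure m B) ^ N\<close>, which tends to 0.\<close>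

lemma null_sets_iid_avoid:
  assumes m: "prob_space m" and B: "B \<in> sets m" "emeasure m B > 0"
  shows "{s \<in> space (PiM UNIV (\<lambda>_ :: nat. m)). \<forall>n. s n \<notin> B} \<in> null_sets (PiM UNIV (\<lambda>_. m))"
proof -
  interpret m: prob_space m by fact
  interpret P: product_prob_space "\<lambda>_. m" "UNIV :: nat set"
    by (simp add: product_prob_space_def product_prob_space_axioms_def product_sigma_finite_def
        m prob_space_imp_sigma_finite)
  let ?P = "PiM UNIV (\<lambda>_ :: nat. m)"
  let ?E = "{s \<in> space ?P. \<forall>n. s n \<notin> B}"
  have E [measurable]: "?E \<in> sets ?P" using B by measurable
  have pos: "measure m B > 0" using B m.emeasure_eq_measure by (simp add: ennreal_less_zero_iff)
  have "measure ?P ?E \<le> (1 - measure m B) ^ N" for N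
  proof -
    have "emeasure ?P ?E \<le> emeasure ?P {s \<in> space ?P. \<forall>n\<in>{..<N}. s n \<in> space m - B}"
    proof (rule emeasure_mono)
      show "{s \<in> space ?P. \<forall>n\<in>{..<N}. s n \<in> space m - B} \<in> sets ?P"
        using B by measurable
    qed (auto simp: space_PiM)
    also have "\<dots> = (\<Prod>n\<in>{..<N}. emeasure m (space m - B))"
      using B by (intro P.emeasure_PiM_Collect) auto
    also have "\<dots> = ennreal ((1 - measure m B) ^ N)"
      using B by (simp add: m.emeasure_eq_measure m.prob_compl ennreal_power)
    finally show ?thesis by (simp add: P.emeasure_eq_measure ennreal_le_iff)
  qed
  moreover have "(\<lambda>N. (1 - measure m B) ^ N) \<longlonglongrightarrow> 0"
    using pos m.prob_le_1[of B] by (intro LIMSEQ_power_zero) auto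
  ultimately have "measure ?P ?E \<le> 0"
    by (intro LIMSEQ_le_const) auto
  then show ?thesis
    using E by (auto simp: null_sets_def P.emeasure_eq_measure measure_le_0_iff)
qed

lemma null_sets_vimage:
  assumes "f \<in> M \<rightarrow>\<^sub>M N" "distr M N f = N" "A \<in> null_sets N"
  shows "f -` A \<inter> space M \<in> null_sets M"
  using null_sets_distr_iff[OF assms(1), of A] assms(2,3) by simp

text \<open>\<open>X\<close> is only known not to be null, so a direct image of it could miss sets
  of positive measure. Sampling sequences cures this: that all entries miss \<open>B\<close> is a
  null event, so some point of \<open>X\<close> yields a sequence with an entry in \<open>B\<close>.
  \<open>Y\<close> collects all entries, at the cost of a factor \<open>nat\<close>.\<close>

lemma exists_small_full_set:
  assumes X: "X \<notin> null_sets (completion (cube_measure (UNIV :: nat set)))"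
    and r: "Cinfinite r" "|X| \<le>o r"
    and m: "prob_space m" "sets m = sets (bits :: (nat \<Rightarrow> bool) measure)"
  obtains Y where "|Y| \<le>o r" "\<And>B. B \<in> sets m \<Longrightarrow> emeasure m B > 0 \<Longrightarrow> Y \<inter> B \<noteq> {}"
proof -
  define \<Phi> :: "(nat \<Rightarrow> bool) \<Rightarrow> nat \<times> nat \<times> nat \<Rightarrow> bool" where "\<Phi> = (\<lambda>\<omega> i. \<omega> (to_nat i))"
  have \<Phi>: "\<Phi> \<in> cube_measure UNIV \<rightarrow>\<^sub>M cube_measure UNIV" "distr (cube_measure UNIV) (cube_measure UNIV) \<Phi> = cube_measure UNIV"
    unfolding \<Phi>_def by (auto intro!: measurable_cube_reindex distr_cube_reindex)
  obtain \<Gamma> where \<Gamma>: "\<Gamma> \<in> cube_measure (UNIV :: (nat \<times> nat \<times> nat) set) \<rightarrow>\<^sub>M PiM UNIV (\<lambda>_ :: nat. m)"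
    "distr (cube_measure UNIV) (PiM UNIV (\<lambda>_. m)) \<Gamma> = PiM UNIV (\<lambda>_. m)"
    using exists_iid_sampling_map[OF m] by metis
  define Y where "Y = (\<lambda>(x, n). \<Gamma> (\<Phi> x) n) ` (X \<times> UNIV)"
  show thesis
  proof
    have "|UNIV :: nat set| \<le>o r"
      using r by (meson card_of_nat natLeq_ordLeq_cinfinite ordIso_ordLeq_trans)
    then have "|X \<times> (UNIV :: nat set)| \<le>o r"
      using r by (intro card_of_Times_ordLeq_infinite_Field) (auto simp: cinfinite_def)
    then show "|Y| \<le>o r"
      unfolding Y_def using card_of_image ordLeq_transitive by blast
    fix B assume B: "B \<in> sets m" "emeasure m B > 0"
    show "Y \<inter> B \<noteq> {}"
    proof
      assume "Y \<inter> B = {}"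
      let ?N = "{s \<in> space (PiM UNIV (\<lambda>_ :: nat. m)). \<forall>n. s n \<notin> B}"
      have N: "?N \<in> null_sets (PiM UNIV (\<lambda>_. m))"
        by (rule null_sets_iid_avoid[OF m(1) B])
      have "\<Phi> -` (\<Gamma> -` ?N \<inter> space (cube_measure UNIV)) \<inter> space (cube_measure UNIV) \<in> null_sets (cube_measure UNIV)"
        by (rule null_sets_vimage[OF \<Phi> null_sets_vimage[OF \<Gamma> N]])
      moreover have "X \<subseteq> \<Phi> -` (\<Gamma> -` ?N \<inter> space (cube_measure UNIV)) \<inter> space (cube_measure UNIV)"
      proof
        fix x assume x: "x \<in> X"
        have "\<Gamma> (\<Phi> x) \<in> space (PiM UNIV (\<lambda>_. m))"
          using measurable_space[OF \<Gamma>(1), of "\<Phi> x"] by simp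
        moreover have "\<Gamma> (\<Phi> x) n \<notin> B" for n
          using \<open>Y \<inter> B = {}\<close> x unfolding Y_def by auto
        ultimately show "x \<in> \<Phi> -` (\<Gamma> -` ?N \<inter> space (cube_measure UNIV)) \<inter> space (cube_measure UNIV)"
          by simp
      qed
      ultimately have "X \<in> null_sets (completion (cube_measure UNIV))"
        by (meson null_sets_completionI null_sets_completion_subset)
      with X show False ..
    qed
  qed
qed

text \<open>Composition with the injection \<open>f\<close> maps the larger cube to the smaller one
  and preserves the measure, so a cover by null sets would lift.\<close>

lemma cube_not_covered_reindex:
  assumes f: "inj (f :: 'k \<Rightarrow> 'l)" "range f \<subseteq> K"
    and K: "\<And>\<A>. \<A> \<subseteq> cube_null K \<Longrightarrow> |\<A>| \<le>o r \<Longrightarrow> \<Union>\<A> \<noteq> cantor_cube K"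
    and N: "\<N> \<subseteq> null_sets (cube_measure (UNIV :: 'k set))" "|\<N>| \<le>o r"
  shows "\<Union>\<N> \<noteq> UNIV"
proof
  assume cover: "\<Union>\<N> = UNIV"
  let ?\<Phi> = "\<lambda>\<omega> i. \<omega> (f i)"
  define \<A> where "\<A> = (\<lambda>N. ?\<Phi> -` N \<inter> space (cube_measure K)) ` \<N>"
  have "\<A> \<subseteq> cube_null K"
    unfolding \<A>_def cube_null_def
    using N(1) null_sets_vimage[OF measurable_cube_reindex[OF f(2)] distr_cube_reindex[OF f]]
    by (auto intro!: null_sets_completionI)
  moreover have "|\<A>| \<le>o r"
    unfolding \<A>_def using N(2) card_of_image ordLeq_transitive by blast
  moreover have "\<Union>\<A> = cantor_cube K"
    unfolding \<A>_def space_cube_measure using cover by auto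
  ultimately show False using K by blast
qed

text \<open>Each requirement excludes a null set of coin tosses: that sample \<open>n\<close> falls
  into a given null set, or that all samples miss a given set of positive measure. There are at most
  \<open>r\<close> many of them.\<close>

lemma exists_random_sequence:
  fixes m :: "('i \<Rightarrow> bool) measure"
  assumes avoid: "\<And>\<N>. \<N> \<subseteq> null_sets (cube_measure (UNIV :: (nat \<times> 'i \<times> nat) set)) \<Longrightarrow> |\<N>| \<le>o r \<Longrightarrow> \<Union>\<N> \<noteq> UNIV"
    and r: "Cinfinite r"
    and m: "prob_space m" "sets m = sets bits"
    and N: "\<N> \<subseteq> null_sets m" "|\<N>| \<le>o r"
    and B: "\<And>B. B \<in> \<B> \<Longrightarrow> B \<in> sets m \<and> emeasure m B > 0" "|\<B>| \<le>o r"
  obtains t :: "nat \<Rightarrow> 'i \<Rightarrow> bool"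
    where "\<And>n N. N \<in> \<N> \<Longrightarrow> t n \<notin> N" "\<And>B. B \<in> \<B> \<Longrightarrow> \<exists>n. t n \<in> B"
proof -
  let ?P = "PiM UNIV (\<lambda>_ :: nat. m)"
  let ?C = "cube_measure (UNIV :: (nat \<times> 'i \<times> nat) set)"
  obtain \<Gamma> where \<Gamma>: "\<Gamma> \<in> ?C \<rightarrow>\<^sub>M ?P" "distr ?C ?P \<Gamma> = ?P"
    using exists_iid_sampling_map[OF m] by metis
  have \<Gamma>_space: "\<Gamma> \<omega> \<in> space ?P" for \<omega>
    using measurable_space[OF \<Gamma>(1), of \<omega>] by simp
  define \<U> where "\<U> = (\<lambda>(n, N). {s \<in> space ?P. s n \<in> N}) ` (UNIV \<times> \<N>) \<union> (\<lambda>B. {s \<in> space ?P. \<forall>n. s n \<notin> B}) ` \<B>"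
  have "\<U> \<subseteq> null_sets ?P"
  proof -
    have "{s \<in> space ?P. s n \<in> A} \<in> null_sets ?P" if "A \<in> \<N>" for n A
    proof -
      have "(\<lambda>s. s n) -` A \<inter> space ?P \<in> null_sets ?P"
        using that N(1) m(1) by (intro null_sets_vimage[where N = m] distr_PiM_component) auto
      then show ?thesis by (simp add: vimage_def Int_def conj_commute)
    qed
    then show ?thesis
      unfolding \<U>_def using null_sets_iid_avoid[OF m(1)] B(1) by auto
  qed
  then have "(\<lambda>U. \<Gamma> -` U \<inter> space ?C) ` \<U> \<subseteq> null_sets ?C"
    using null_sets_vimage[OF \<Gamma>] by auto
  moreover have "|(\<lambda>U. \<Gamma> -` U \<inter> space ?C) ` \<U>| \<le>o r"
  proof -
    have fin: "\<not> finite (Field r)" using r by (simp add: cinfinite_def)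
    have nat: "|UNIV :: nat set| \<le>o r"
      using r by (meson card_of_nat natLeq_ordLeq_cinfinite ordIso_ordLeq_trans)
    have "|\<U>| \<le>o r"
      unfolding \<U>_def using N B r fin nat
      by (intro card_of_Un_ordLeq_infinite_Field card_of_Times_ordLeq_infinite_Field
          ordLeq_transitive[OF card_of_image]) auto
    then show ?thesis using card_of_image ordLeq_transitive by blast
  qed
  ultimately have "\<Union>((\<lambda>U. \<Gamma> -` U \<inter> space ?C) ` \<U>) \<noteq> UNIV"
    by (rule avoid)
  then obtain \<omega> where \<omega>: "\<And>U. U \<in> \<U> \<Longrightarrow> \<Gamma> \<omega> \<notin> U"
    by auto
  show thesis
  proof
    show "\<Gamma> \<omega> n \<notin> A" if "A \<in> \<N>" for n A
      using \<omega>[of "{s \<in> space ?P. s n \<in> A}"] that \<Gamma>_space[of \<omega>] by (auto simp: \<U>_def)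
    show "\<exists>n. \<Gamma> \<omega> n \<in> B" if "B \<in> \<B>" for B
      using \<omega>[of "{s \<in> space ?P. \<forall>n. s n \<notin> B}"] that \<Gamma>_space[of \<omega>] by (auto simp: \<U>_def)
  qed
qed

subsection \<open>Lebesgue density along cylinders\<close>

definition cyl :: "nat \<Rightarrow> (nat \<Rightarrow> bool) \<Rightarrow> (nat \<Rightarrow> bool) set" where
  "cyl k y = {x. \<forall>i<k. x i = y i}"

lemma cyl_self [simp]: "y \<in> cyl k y"
  by (simp add: cyl_def)

lemma cyl_mono: "n \<le> k \<Longrightarrow> cyl k y \<subseteq> cyl n y"
  by (auto simp: cyl_def)

lemma cyl_eq: "x \<in> cyl k y \<Longrightarrow> cyl k x = cyl k y"
  by (auto simp: cyl_def)

lemma cyl_disjoint: "cyl k x \<noteq> cyl k y \<Longrightarrow> cyl k x \<inter> cyl k y = {}"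
  using cyl_eq by (metis disjoint_iff)

lemma finite_range_cyl: "finite (range (cyl k))"
proof (rule finite_subset)
  show "range (cyl k) \<subseteq> (\<lambda>S. {x. \<forall>i<k. x i = (i \<in> S)}) ` Pow {..<k}"
  proof
    fix A assume "A \<in> range (cyl k)"
    then obtain y where "A = cyl k y" by blast
    then show "A \<in> (\<lambda>S. {x. \<forall>i<k. x i = (i \<in> S)}) ` Pow {..<k}"
      by (intro image_eqI[where x = "{i. i < k \<and> y i}"]) (auto simp: cyl_def)
  qed
qed simp

lemma sets_cyl [measurable]: "cyl k y \<in> sets bits"
proof -
  have "{x \<in> space bits. \<forall>i<k. x i = y i} \<in> sets bits" by measurable
  then show ?thesis by (simp add: cyl_def)
qed

text \<open>These are the sets that depend on the first \<open>k\<close> coordinates only; they are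
  finite unions of cylinders.\<close>

definition saturated :: "nat \<Rightarrow> (nat \<Rightarrow> bool) set \<Rightarrow> bool" where
  "saturated k D \<longleftrightarrow> (\<forall>x\<in>D. cyl k x \<subseteq> D)"

lemma saturated_Union: "saturated k D \<Longrightarrow> D = \<Union>(cyl k ` D)"
  by (auto simp: saturated_def)

lemma saturated_mono: "saturated n D \<Longrightarrow> n \<le> k \<Longrightarrow> saturated k D"
  unfolding saturated_def using cyl_mono by blast

lemma sets_saturated:
  assumes "saturated k D"
  shows "D \<in> sets bits"
proof -
  have "\<Union>(cyl k ` D) \<in> sets bits"
    by (intro sets.finite_Union finite_subset[OF _ finite_range_cyl]) auto
  then show ?thesis
    using saturated_Union[OF assms] by metis
qed

lemma measure_saturated_le:
  assumes m: "finite_measure m" "sets m = sets bits" and D: "saturated k D" and C: "C \<in> sets m"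
    and le: "\<And>x. x \<in> D \<Longrightarrow> c * measure m (cyl k x) \<le> measure m (C \<inter> cyl k x)"
  shows "c * measure m D \<le> measure m (C \<inter> D)"
proof -
  interpret finite_measure m by fact
  note [measurable_cong] = m(2)
  let ?S = "cyl k ` D"
  have fin: "finite ?S" by (rule finite_subset[OF _ finite_range_cyl]) auto
  have disj: "disjoint_family_on (\<lambda>A. A) ?S" "disjoint_family_on (\<lambda>A. C \<inter> A) ?S"
    using cyl_disjoint by (fastforce simp: disjoint_family_on_def)+
  have "measure m (\<Union>A\<in>?S. A) = (\<Sum>A\<in>?S. measure m A)"
    by (rule finite_measure_finite_Union[OF fin _ disj(1)]) (auto simp: m(2))
  moreover have "measure m (\<Union>A\<in>?S. C \<inter> A) = (\<Sum>A\<in>?S. measure m (C \<inter> A))"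
    by (rule finite_measure_finite_Union[OF fin _ disj(2)]) (use C in \<open>auto simp: m(2)\<close>)
  moreover have "(\<Union>A\<in>?S. A) = D" "(\<Union>A\<in>?S. C \<inter> A) = C \<inter> D"
    using saturated_Union[OF D] by auto
  moreover have "c * (\<Sum>A\<in>?S. measure m A) \<le> (\<Sum>A\<in>?S. measure m (C \<inter> A))"
    unfolding sum_distrib_left using le by (intro sum_mono) auto
  ultimately show ?thesis by simp
qed

text \<open>A stopping argument: \<open>F k\<close> collects the points for which \<open>k\<close>
  is the first level with density at least \<open>c\<close>. Membership depends on the first
  \<open>k\<close> coordinates alone, so the bound can be summed over cylinders inside
  \<open>F k\<close>, and then over the disjoint sets \<open>F k\<close>, whose union is
  \<open>M\<close>.\<close>

lemma maximal_inequality: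
  assumes m: "finite_measure m" "sets m = sets bits" and C: "C \<in> sets m"
    and M_def: "M = {y. \<exists>k. c * measure m (cyl k y) \<le> measure m (C \<inter> cyl k y)}"
  shows "M \<in> sets m" "c * measure m M \<le> measure m C"
proof -
  interpret finite_measure m by fact
  define P where "P k y \<longleftrightarrow> c * measure m (cyl k y) \<le> measure m (C \<inter> cyl k y)" for k y
  define F where "F k = {y. P k y \<and> (\<forall>i<k. \<not> P i y)}" for k
  have P_cong: "P i x \<longleftrightarrow> P i y" if "x \<in> cyl k y" "i \<le> k" for x y i k
    using cyl_eq[of x i y] cyl_mono[OF that(2), of y] that(1) by (auto simp: P_def)
  have sat: "saturated k (F k)" for k
    unfolding saturated_def F_def using P_cong[where k = k] by auto
  have sF: "F k \<in> sets m" for k using sets_saturated[OF sat] m(2) by simp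
  have M: "M = (\<Union>k. F k)"
  proof safe
    fix y assume "y \<in> M"
    then have "\<exists>k. P k y" by (simp add: M_def P_def)
    then have "y \<in> F (LEAST k. P k y)"
      unfolding F_def by (auto intro: LeastI_ex dest: not_less_Least)
    then show "y \<in> (\<Union>k. F k)" by blast
  qed (auto simp: F_def M_def P_def)
  then show "M \<in> sets m" using sF by auto
  have disj: "disjoint_family F"
    unfolding disjoint_family_on_def F_def by (auto, metis linorder_neqE_nat)
  have F_le: "c * measure m (F k) \<le> measure m (C \<inter> F k)" for k
    by (rule measure_saturated_le[OF m sat C]) (simp add: F_def P_def)
  have "(\<lambda>k. measure m (F k)) sums measure m M"
    unfolding M using sF disj by (intro finite_measure_UNION) auto
  then have 1: "(\<lambda>k. c * measure m (F k)) sums (c * measure m M)"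
    by (rule sums_mult)
  have "disjoint_family (\<lambda>k. C \<inter> F k)" using disj by (auto simp: disjoint_family_on_def)
  then have 2: "(\<lambda>k. measure m (C \<inter> F k)) sums measure m (\<Union>k. C \<inter> F k)"
    using sF C by (intro finite_measure_UNION) auto
  have "c * measure m M \<le> measure m (\<Union>k. C \<inter> F k)"
    by (rule sums_le[OF F_le 1 2])
  also have "\<dots> \<le> measure m C"
    using sF C by (intro finite_measure_mono) auto
  finally show "c * measure m M \<le> measure m C" .
qed

text \<open>Induction over the generated \<sigma>-algebra. Coordinate events are saturated,
  complements keep the error, and a countable union is first cut to a finite one.\<close>

lemma saturated_approximation:
  assumes m: "finite_measure m" "sets m = sets bits" and B: "B \<in> sets m" and e: "e > 0"
  shows "\<exists>k D. saturated k D \<and> measure m (B - D) + measure m (D - B) < e"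
proof -
  interpret finite_measure m by fact
  have sat_sets: "saturated k D \<Longrightarrow> D \<in> sets m" for k D
    using sets_saturated m(2) by blast
  define \<G> where "\<G> = {{x. x i} | i :: nat. True}"
  have "B \<in> sigma_sets UNIV \<G>"
  proof -
    have "{A. \<exists>i\<in>UNIV. \<exists>X. A = (\<lambda>f. f i) -` X \<inter> UNIV} \<subseteq> sigma_sets UNIV \<G>"
    proof safe
      fix i :: nat and X :: "bool set"
      have 1: "{x. x i} \<in> sigma_sets UNIV \<G>" by (auto simp: \<G>_def)
      from sigma_sets.Compl[OF this] have 2: "{x. \<not> x i} \<in> sigma_sets UNIV \<G>"
        by (simp add: Compl_eq_Diff_UNIV[symmetric] Collect_neg_eq)
      have "(\<lambda>f. f i) -` X \<inter> UNIV = (if True \<in> X then {x. x i} else {}) \<union> (if False \<in> X then {x. \<not> x i} else {})"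
      proof (rule set_eqI)
        fix x show "x \<in> (\<lambda>f. f i) -` X \<inter> UNIV \<longleftrightarrow>
            x \<in> (if True \<in> X then {x. x i} else {}) \<union> (if False \<in> X then {x. \<not> x i} else {})"
          by (cases "x i") auto
      qed
      then show "(\<lambda>f. f i) -` X \<inter> UNIV \<in> sigma_sets UNIV \<G>"
        using 1 2 by (auto intro: sigma_sets_Un sigma_sets.Empty)
    qed
    then have "sigma_sets UNIV {A. \<exists>i\<in>UNIV. \<exists>X. A = (\<lambda>f. f i) -` X \<inter> UNIV} \<subseteq> sigma_sets UNIV \<G>"
      by (rule sigma_sets_mono)
    moreover have "sets (bits :: (nat \<Rightarrow> bool) measure) = sigma_sets UNIV {A. \<exists>i\<in>UNIV. \<exists>X. A = (\<lambda>f. f i) -` X \<inter> UNIV}"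
      by (simp add: sets_PiM_single)
        (intro arg_cong[where f = "sigma_sets UNIV"], auto simp: vimage_def)
    ultimately show ?thesis using B m(2) by auto
  qed
  then show ?thesis
    using e
  proof (induction arbitrary: e)
    case (Basic a)
    then obtain i where "a = {x. x i}" by (auto simp: \<G>_def)
    then have "saturated (Suc i) a" by (auto simp: saturated_def cyl_def)
    then show ?case using Basic(2) by (intro exI[of _ "Suc i"] exI[of _ a]) simp
  next
    case Empty
    then show ?case by (intro exI[of _ 0] exI[of _ "{}"]) (simp add: saturated_def)
  next
    case (Compl a)
    from Compl.IH[OF Compl.prems] obtain k D
      where D: "saturated k D" "measure m (a - D) + measure m (D - a) < e" by blast
    have "saturated k (- D)"
      using D(1) cyl_eq cyl_self unfolding saturated_def by blast
    moreover have "(UNIV - a) - (- D) = D - a" "(- D) - (UNIV - a) = a - D" by auto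
    ultimately show ?case using D(2) by (metis add.commute)
  next
    case (Union a)
    have a: "a i \<in> sets m" for i
    proof -
      have "\<G> \<subseteq> sets m"
      proof
        fix g assume "g \<in> \<G>"
        then obtain i where "g = {x. x i}" by (auto simp: \<G>_def)
        then have "saturated (Suc i) g" by (auto simp: saturated_def cyl_def)
        then show "g \<in> sets m" by (rule sat_sets)
      qed
      moreover have "space m = UNIV" using sets_eq_imp_space_eq[OF m(2)] by simp
      ultimately show ?thesis using Union.hyps sets.sigma_sets_subset[of \<G> m] by auto
    qed
    define A where "A n = (\<Union>i<n. a i)" for n
    have "incseq A" unfolding A_def by (intro monoI UN_mono) auto
    moreover have "range A \<subseteq> sets m" using a by (auto simp: A_def)
    ultimately have "(\<lambda>n. measure m (A n)) \<longlonglongrightarrow> measure m (\<Union>n. A n)"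
      by (intro finite_Lim_measure_incseq)
    moreover have A_UN: "(\<Union>n. A n) = (\<Union>i. a i)" by (auto simp: A_def)
    ultimately have "\<forall>\<^sub>F n in sequentially. dist (measure m (A n)) (measure m (\<Union>i. a i)) < e / 2"
      using Union.prems by (intro tendstoD) auto
    then obtain N where N: "dist (measure m (A N)) (measure m (\<Union>i. a i)) < e / 2"
      by (auto simp: eventually_sequentially)
    have A_sets: "A N \<in> sets m" using a by (auto simp: A_def)
    have A_sub: "A N \<subseteq> (\<Union>i. a i)" by (auto simp: A_def)
    have rest: "measure m ((\<Union>i. a i) - A N) < e / 2"
    proof -
      have "measure m ((\<Union>i. a i) - A N) = measure m (\<Union>i. a i) - measure m (A N)"
        using a A_sets A_sub by (intro finite_measure_Diff) auto
      then show ?thesis using N unfolding dist_real_def by linarith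
    qed
    \<comment> \<open>Half of \<open>e\<close> is spent on the tail of the union, and
      \<open>d\<close> bounds each of the \<open>N\<close> remaining errors; \<open>N + 1\<close>
      keeps the denominator positive.\<close>
    define d where "d = e / (2 * (real N + 1))"
    have d: "d > 0" using Union.prems by (simp add: d_def)
    have "\<forall>i. \<exists>k D. saturated k D \<and> measure m (a i - D) + measure m (D - a i) < d"
      using Union.IH d by blast
    then obtain k D where kD: "\<And>i. saturated (k i) (D i)"
      "\<And>i. measure m (a i - D i) + measure m (D i - a i) < d"
      by metis
    have D_sets: "D i \<in> sets m" for i using kD(1) sat_sets by blast
    define K where "K = Max (insert 0 (k ` {..<N}))"
    have "saturated K (D i)" if "i < N" for i
      using that by (intro saturated_mono[OF kD(1)]) (auto simp: K_def)
    then have sat: "saturated K (\<Union>i<N. D i)"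
      unfolding saturated_def by blast
    let ?D = "\<Union>i<N. D i"
    have 1: "measure m ((\<Union>i. a i) - ?D) \<le> measure m ((\<Union>i. a i) - A N) + (\<Sum>i<N. measure m (a i - D i))"
    proof -
      have "measure m ((\<Union>i. a i) - ?D) \<le> measure m (((\<Union>i. a i) - A N) \<union> (\<Union>i<N. a i - D i))"
        using a A_sets D_sets by (intro finite_measure_mono) (auto simp: A_def)
      also have "\<dots> \<le> measure m ((\<Union>i. a i) - A N) + measure m (\<Union>i<N. a i - D i)"
        using a A_sets D_sets by (intro measure_Un_le) auto
      also have "measure m (\<Union>i<N. a i - D i) \<le> (\<Sum>i<N. measure m (a i - D i))"
        using a D_sets by (intro measure_UNION_le) auto
      finally show ?thesis by simp
    qed
    have 2: "measure m (?D - (\<Union>i. a i)) \<le> (\<Sum>i<N. measure m (D i - a i))"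
    proof -
      have "measure m (?D - (\<Union>i. a i)) \<le> measure m (\<Union>i<N. D i - a i)"
        using a D_sets by (intro finite_measure_mono) auto
      also have "\<dots> \<le> (\<Sum>i<N. measure m (D i - a i))"
        using a D_sets by (intro measure_UNION_le) auto
      finally show ?thesis .
    qed
    have "(\<Sum>i<N. measure m (a i - D i)) + (\<Sum>i<N. measure m (D i - a i)) \<le> (\<Sum>i<N. d)"
      unfolding sum.distrib[symmetric] using kD(2) by (intro sum_mono) (simp add: less_imp_le)
    also have "\<dots> \<le> e / 2"
      using Union.prems by (simp add: d_def field_simps)
    finally show ?case
      using 1 2 rest sat by (intro exI[of _ K] exI[of _ ?D]) auto
  qed
qed

text \<open>Approximate \<open>B\<close> by saturated sets \<open>D j\<close> with rapidly
  decreasing errors. \<open>M j\<close> is the set of points having a cylinder in which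
  \<open>D j - B\<close> has density at least \<open>2^-j\<close>; it is small by the maximal
  inequality. A point of \<open>B\<close> that lies in all \<open>D j\<close> and in no
  \<open>M j\<close> has its cylinders inside \<open>D j\<close> from level \<open>n j\<close> on,
  and there the part outside \<open>B\<close> has density below \<open>2^-j\<close>.\<close>

theorem cylinder_density:
  assumes m: "finite_measure m" "sets m = sets bits" and B: "B \<in> sets m" "measure m B > 0"
  obtains B' where "B' \<in> sets m" "emeasure m B' > 0" "\<And>y k. y \<in> B' \<Longrightarrow> measure m (cyl k y) > 0"
    "\<And>y e. y \<in> B' \<Longrightarrow> e > 0 \<Longrightarrow> \<exists>n. \<forall>k\<ge>n. measure m (cyl k y - B) \<le> e * measure m (cyl k y)"
proof -
  interpret finite_measure m by fact
  let ?b = "measure m B"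
  have "\<exists>k D. saturated k D \<and> measure m (B - D) + measure m (D - B) < ?b * (1/4) ^ Suc j / 2" for j
    by (rule saturated_approximation[OF m B(1)]) (use B(2) in simp)
  then obtain n D where D: "\<And>j. saturated (n j) (D j)"
    "\<And>j. measure m (B - D j) + measure m (D j - B) < ?b * (1/4) ^ Suc j / 2"
    by metis
  have D_sets: "D j \<in> sets m" for j using sets_saturated[OF D(1)] m(2) by simp
  define M where "M j = {y. \<exists>k. (1/2) ^ j * measure m (cyl k y) \<le> measure m ((D j - B) \<inter> cyl k y)}" for j
  have M_sets: "M j \<in> sets m" for j
    by (rule maximal_inequality(1)[OF m _ M_def]) (use D_sets B in auto)
  have M_le: "(1/2) ^ j * measure m (M j) \<le> measure m (D j - B)" for j
    by (rule maximal_inequality(2)[OF m _ M_def]) (use D_sets B in auto)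
  define B' where "B' = B - (\<Union>j. (B - D j) \<union> M j)"
  \<comment> \<open>The error \<open>b 4^-(j+1) / 2\<close> times the factor \<open>2^j\<close> lost
    in the maximal inequality is \<open>b/4 * 2^-(j+1)\<close>, and these sum to \<open>b/4\<close>,
    which leaves part of \<open>B\<close>.\<close>
  have bound: "measure m ((B - D j) \<union> M j) \<le> ?b / 4 * (1/2) ^ Suc j" for j
  proof -
    have "measure m (M j) \<le> 2 ^ j * measure m (D j - B)"
      using M_le[of j] by (simp add: power_one_over field_simps)
    moreover have "measure m (B - D j) \<le> 2 ^ j * measure m (B - D j)"
      by (simp add: mult_le_cancel_right1)
    moreover have "measure m ((B - D j) \<union> M j) \<le> measure m (B - D j) + measure m (M j)"
      using D_sets M_sets B by (intro measure_Un_le) auto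
    ultimately have "measure m ((B - D j) \<union> M j) \<le> 2 ^ j * (measure m (B - D j) + measure m (D j - B))"
      by (simp add: distrib_left)
    also have "\<dots> \<le> 2 ^ j * (?b * (1/4) ^ Suc j / 2)"
      using D(2)[of j] by (intro mult_left_mono) auto
    also have "\<dots> = ?b / 4 * (1/2) ^ Suc j * (2 ^ j * (1/4) ^ j * 2 ^ j)"
      by (simp add: power_one_over field_simps)
    also have "(2 ^ j * (1/4) ^ j * 2 ^ j :: real) = 1"
      by (simp add: power_mult_distrib[symmetric])
    finally show ?thesis by simp
  qed
  have sums: "(\<lambda>j. ?b / 4 * (1/2) ^ Suc j) sums (?b / 4 * 1)"
    by (intro sums_mult power_half_series)
  have summ: "summable (\<lambda>j. measure m ((B - D j) \<union> M j))"
    by (rule summable_comparison_test[OF _ sums_summable[OF sums]]) (use bound in auto)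
  have "measure m (\<Union>j. (B - D j) \<union> M j) \<le> (\<Sum>j. measure m ((B - D j) \<union> M j))"
    by (rule finite_measure_subadditive_countably[OF _ summ]) (use D_sets M_sets B in auto)
  also have "\<dots> \<le> ?b / 4"
    using suminf_le[OF bound summ sums_summable[OF sums]] sums_unique[OF sums] by simp
  finally have "measure m (\<Union>j. (B - D j) \<union> M j) \<le> ?b / 4" .
  moreover have "measure m B \<le> measure m B' + measure m (\<Union>j. (B - D j) \<union> M j)"
  proof -
    have "measure m B \<le> measure m (B' \<union> (\<Union>j. (B - D j) \<union> M j))"
      using D_sets M_sets B by (intro finite_measure_mono) (auto simp: B'_def)
    also have "\<dots> \<le> measure m B' + measure m (\<Union>j. (B - D j) \<union> M j)"
      using D_sets M_sets B by (intro measure_Un_le) (auto simp: B'_def)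
    finally show ?thesis .
  qed
  ultimately have pos: "measure m B' > 0" using B(2) by simp
  show thesis
  proof
    show "B' \<in> sets m" using D_sets M_sets B by (auto simp: B'_def)
    show "emeasure m B' > 0" using pos by (simp add: emeasure_eq_measure ennreal_less_zero_iff)
    fix y assume y: "y \<in> B'"
    then have yD: "y \<in> D j" "y \<notin> M j" for j by (auto simp: B'_def)
    \<comment> \<open>The inequality defining \<open>M j\<close> is not strict, so points of null
      cylinders belong to \<open>M j\<close>. Strictness off \<open>M j\<close> therefore also
      yields positivity of all cylinders.\<close>
    have less: "measure m ((D j - B) \<inter> cyl k y) < (1/2) ^ j * measure m (cyl k y)" for j k
      using yD(2)[of j] by (auto simp: M_def not_le)
    show "measure m (cyl k y) > 0" for k
      using le_less_trans[OF measure_nonneg less[of 0 k]] by simp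
    fix e :: real assume "e > 0"
    then obtain j where j: "(1/2) ^ j < e"
      using real_arch_pow_inv[of e "1/2"] by auto
    show "\<exists>n. \<forall>k\<ge>n. measure m (cyl k y - B) \<le> e * measure m (cyl k y)"
    proof (intro exI allI impI)
      fix k assume k: "n j \<le> k"
      have "cyl k y \<subseteq> D j"
        using saturated_mono[OF D(1) k] yD(1) by (auto simp: saturated_def)
      then have "cyl k y - B = (D j - B) \<inter> cyl k y" by auto
      then have "measure m (cyl k y - B) \<le> (1/2) ^ j * measure m (cyl k y)"
        using less[of j k] by simp
      also have "\<dots> \<le> e * measure m (cyl k y)"
        using j by (intro mult_right_mono) auto
      finally show "measure m (cyl k y - B) \<le> e * measure m (cyl k y)" .
    qed
  qed
qed

subsection \<open>Random points of a compact space\<close>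

lemma Cinfinite_natLeq_le:
  assumes "Cinfinite r" shows "|UNIV :: nat set| \<le>o r"
  by (rule ordIso_ordLeq_trans[OF card_of_nat natLeq_ordLeq_cinfinite[OF assms]])

lemma card_image_ordLeq: "|A| \<le>o r \<Longrightarrow> |f ` A| \<le>o r"
  by (rule ordLeq_transitive[OF card_of_image])

lemma countable_ordLeq:
  assumes "countable A" "Cinfinite r" shows "|A| \<le>o r"
proof -
  obtain f :: "'a \<Rightarrow> nat" where "inj_on f A" using assms(1) by (rule countableE)
  then have "|A| \<le>o |UNIV :: nat set|" by (intro card_of_ordLeqI) auto
  then show ?thesis using Cinfinite_natLeq_le[OF assms(2)] by (rule ordLeq_transitive)
qed

lemma Times_ordLeq:
  assumes "Cinfinite r" "|A| \<le>o r" "|B| \<le>o r" shows "|A \<times> B| \<le>o r"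
  using assms by (intro card_of_Times_ordLeq_infinite_Field) (auto simp: cinfinite_def)

lemma UNION_ordLeq:
  assumes "Cinfinite r" "|I| \<le>o r" "\<And>i. i \<in> I \<Longrightarrow> |A i| \<le>o r" shows "|\<Union>i\<in>I. A i| \<le>o r"
  using assms by (intro UNION_Cinfinite_bound) auto

lemma finite_subsets_ordLeq:
  assumes r: "Cinfinite r" and J: "|J| \<le>o r"
  shows "|{a. finite a \<and> a \<subseteq> J}| \<le>o r"
proof -
  \<comment> \<open>\<open>S n\<close> consists of the sets made from elements of \<open>J\<close>
    by \<open>n\<close> insertions, repetitions allowed.\<close>
  define S where "S = rec_nat {{}} (\<lambda>_ T. (\<lambda>(x, a). insert x a) ` (J \<times> T))"
  have S: "|S n| \<le>o r" for n
  proof (induction n)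
    case 0
    then show ?case using r by (simp add: S_def countable_ordLeq)
  next
    case (Suc n)
    then show ?case using r J by (simp add: S_def card_image_ordLeq Times_ordLeq)
  qed
  have "a \<in> (\<Union>n. S n)" if "finite a" "a \<subseteq> J" for a
    using that
  proof (induction a)
    case empty
    have "{} \<in> S 0" by (simp add: S_def)
    then show ?case by blast
  next
    case (insert x a)
    then obtain n where "a \<in> S n" by auto
    then have "insert x a \<in> S (Suc n)"
      using insert.prems by (force simp: S_def)
    then show ?case by blast
  qed
  then have "{a. finite a \<and> a \<subseteq> J} \<subseteq> (\<Union>n. S n)" by blast
  moreover have "|\<Union>n. S n| \<le>o r"
    using r S by (intro UNION_ordLeq Cinfinite_natLeq_le)
  ultimately show ?thesis by (rule ordLeq_transitive[OF card_of_mono1])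
qed

lemma regular_space_shrink:
  assumes "regular_space K" "openin K V" "x \<in> V"
  obtains U where "openin K U" "x \<in> U" "K closure_of U \<subseteq> V"
proof -
  have "closedin K (topspace K - V)" "x \<in> topspace K - (topspace K - V)"
    using assms openin_subset by auto
  then have "\<exists>U V'. openin K U \<and> openin K V' \<and> x \<in> U \<and> topspace K - V \<subseteq> V' \<and> disjnt U V'"
    by (intro assms(1)[unfolded regular_space_def, rule_format] conjI)
  then obtain U V' where UV: "openin K U" "openin K V'" "x \<in> U" "topspace K - V \<subseteq> V'" "disjnt U V'"
    by blast
  have "K closure_of U \<subseteq> topspace K - V'"
    using UV openin_subset[OF UV(1)] by (intro closure_of_minimal) (auto simp: disjnt_def)
  with UV(4) show thesis by (intro that[OF UV(1,3)]) auto
qed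

lemma normal_space_shrink:
  assumes "normal_space K" "closedin K F" "openin K V" "F \<subseteq> V"
  obtains U where "openin K U" "F \<subseteq> U" "K closure_of U \<subseteq> V"
proof -
  have "closedin K (topspace K - V)" "disjnt F (topspace K - V)"
    using assms by (auto simp: disjnt_def)
  with assms(2) have "\<exists>U V'. openin K U \<and> openin K V' \<and> F \<subseteq> U \<and> topspace K - V \<subseteq> V' \<and> disjnt U V'"
    by (intro assms(1)[unfolded normal_space_def, rule_format] conjI)
  then obtain U V' where UV: "openin K U" "openin K V'" "F \<subseteq> U" "topspace K - V \<subseteq> V'" "disjnt U V'"
    by blast
  have "K closure_of U \<subseteq> topspace K - V'"
    using UV openin_subset[OF UV(1)] by (intro closure_of_minimal) (auto simp: disjnt_def)
  with UV(4) show thesis by (intro that[OF UV(1,3)]) auto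
qed

locale compact_radon =
  fixes K :: "'a topology" and \<mu> :: "'a measure"
  assumes compact: "compact_space K" and Hausdorff: "Hausdorff_space K"
    and radon: "radon_measure_on K \<mu>"
begin

sublocale finite_measure \<mu>
  using radon by (simp add: radon_measure_on_def)

lemma space_mu [simp]: "space \<mu> = topspace K"
  using radon by (simp add: radon_measure_on_def)

lemma open_sets: "openin K U \<Longrightarrow> U \<in> sets \<mu>"
  using radon by (auto simp: radon_measure_on_def)

lemma closed_sets:
  assumes "closedin K F" shows "F \<in> sets \<mu>"
proof -
  have "space \<mu> - (topspace K - F) \<in> sets \<mu>"
    by (intro sets.compl_sets open_sets openin_diff assms openin_topspace)
  moreover have "space \<mu> - (topspace K - F) = F" using closedin_subset[OF assms] by auto
  ultimately show ?thesis by simp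
qed

lemma regular: "regular_space K"
  by (rule compact_Hausdorff_imp_regular_space[OF compact Hausdorff])

lemma normal: "normal_space K"
  by (rule compact_Hausdorff_or_regular_imp_normal_space[OF compact disjI1[OF Hausdorff]])

text \<open>The distribution of the record of memberships, through which events generated by the
  \<open>U i\<close> become events of a cube.\<close>

definition law :: "'a measure \<Rightarrow> ('i \<Rightarrow> 'a set) \<Rightarrow> ('i \<Rightarrow> bool) measure" where
  "law \<nu> U = distr \<nu> bits (\<lambda>x i. x \<in> U i)"

lemma measurable_indicators:
  assumes "sets \<nu> = sets \<mu>" "\<And>i. U i \<in> sets \<mu>"
  shows "(\<lambda>x i. x \<in> U i) \<in> \<nu> \<rightarrow>\<^sub>M bits"
  unfolding measurable_to_bits using assms by auto

lemma law_props:
  assumes "prob_space \<nu>" "sets \<nu> = sets \<mu>" "\<And>i. U i \<in> sets \<mu>"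
  shows "prob_space (law \<nu> U)" "sets (law \<nu> U) = sets bits"
    "B \<in> sets bits \<Longrightarrow> emeasure (law \<nu> U) B = emeasure \<nu> {x \<in> topspace K. (\<lambda>i. x \<in> U i) \<in> B}"
proof -
  have sp: "space \<nu> = topspace K" using sets_eq_imp_space_eq[OF assms(2)] by simp
  note meas = measurable_indicators[OF assms(2), of U, OF assms(3)]
  show "prob_space (law \<nu> U)" unfolding law_def by (rule prob_space.prob_space_distr[OF assms(1) meas])
  show "sets (law \<nu> U) = sets bits" by (simp add: law_def)
  assume B: "B \<in> sets bits"
  show "emeasure (law \<nu> U) B = emeasure \<nu> {x \<in> topspace K. (\<lambda>i. x \<in> U i) \<in> B}"
    unfolding law_def by (subst emeasure_distr[OF meas B]) (auto simp: sp intro!: arg_cong[where f = "emeasure \<nu>"])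
qed

text \<open>Positive measure makes each finite part of the pattern \<open>t\<close> realisable, so
  the closures of the selected sets have the finite intersection property. The sets themselves need
  not share a point.\<close>

lemma compactness_point:
  assumes \<nu>: "sets \<nu> = sets \<mu>"
    and pos: "\<And>a. finite a \<Longrightarrow> a \<subseteq> J \<Longrightarrow> emeasure \<nu> {x \<in> topspace K. \<forall>i\<in>a. x \<in> U i \<longleftrightarrow> t i} > 0"
  obtains x where "x \<in> topspace K" "\<And>i. i \<in> J \<Longrightarrow> t i \<Longrightarrow> x \<in> K closure_of U i"
    "\<And>i. i \<in> J \<Longrightarrow> \<not> t i \<Longrightarrow> x \<in> K closure_of (topspace K - U i)"
proof -
  define T where "T i = (if t i then U i else topspace K - U i)" for i
  \<comment> \<open>Including \<open>topspace K\<close> places the common point in K even for empty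
    \<open>J\<close>.\<close>
  let ?\<U> = "insert (topspace K) ((\<lambda>i. K closure_of T i) ` J)"
  have "\<Inter>F \<noteq> {}" if F: "finite F" "F \<subseteq> ?\<U>" for F
  proof -
    have "F - {topspace K} \<subseteq> (\<lambda>i. K closure_of T i) ` J" using F by auto
    then obtain a where a: "a \<subseteq> J" "finite a" "F - {topspace K} = (\<lambda>i. K closure_of T i) ` a"
      using F by (meson finite_Diff finite_subset_image)
    have "{x \<in> topspace K. \<forall>i\<in>a. x \<in> U i \<longleftrightarrow> t i} \<noteq> {}"
    proof
      assume "{x \<in> topspace K. \<forall>i\<in>a. x \<in> U i \<longleftrightarrow> t i} = {}"
      with pos[OF a(2,1)] show False by (simp only: emeasure_empty)
    qed
    then obtain x where x: "x \<in> topspace K" "\<forall>i\<in>a. x \<in> U i \<longleftrightarrow> t i" by blast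
    have "x \<in> K closure_of T i" if "i \<in> a" for i
      using x that closure_of_subset_Int[of K "T i"] by (auto simp: T_def)
    then have "x \<in> C" if "C \<in> F" for C
      using that x(1) a(3) by (cases "C = topspace K") auto
    then show ?thesis by blast
  qed
  then have "\<Inter>?\<U> \<noteq> {}"
    by (intro compact[unfolded compact_space_fip, rule_format]) auto
  then obtain x where x: "x \<in> topspace K" "\<And>i. i \<in> J \<Longrightarrow> x \<in> K closure_of T i" by auto
  show thesis
  proof
    show "x \<in> topspace K" by (rule x(1))
    show "x \<in> K closure_of U i" if "i \<in> J" "t i" for i using x(2)[OF that(1)] that(2) by (simp add: T_def)
    show "x \<in> K closure_of (topspace K - U i)" if "i \<in> J" "\<not> t i" for i
      using x(2)[OF that(1)] that(2) by (simp add: T_def)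
  qed
qed

end

text \<open>Indices are pairs of a stage in \<open>'k\<close> and a level in \<open>nat\<close>. The
  outer factors \<open>nat\<close> in \<open>avoid\<close> are those added by independent sampling:
  the number of the sample and the coins per bit.\<close>

locale compact_radon_random = compact_radon +
  fixes \<kappa> :: "'k rel"
  assumes Cinf: "Cinfinite \<kappa>"
    and avoid: "\<And>\<N>. \<N> \<subseteq> null_sets (cube_measure (UNIV :: (nat \<times> ('k \<times> nat) \<times> nat) set)) \<Longrightarrow>
      |\<N>| \<le>o \<kappa> \<Longrightarrow> \<Union>\<N> \<noteq> UNIV"
begin

lemma exists_random_points:
  fixes U :: "'k \<times> nat \<Rightarrow> 'a set"
  assumes \<nu>: "prob_space \<nu>" "sets \<nu> = sets \<mu>" and U: "\<And>i. U i \<in> sets \<mu>" and J: "|J| \<le>o \<kappa>"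
    and N: "\<N> \<subseteq> null_sets (law \<nu> U)" "|\<N>| \<le>o \<kappa>"
    and B: "\<And>B. B \<in> \<B> \<Longrightarrow> B \<in> sets bits \<and> emeasure (law \<nu> U) B > 0" "|\<B>| \<le>o \<kappa>"
  obtains t :: "nat \<Rightarrow> 'k \<times> nat \<Rightarrow> bool" and x
  where "\<And>n N. N \<in> \<N> \<Longrightarrow> t n \<notin> N" "\<And>B. B \<in> \<B> \<Longrightarrow> \<exists>n. t n \<in> B"
    "\<And>n. x n \<in> topspace K" "\<And>n i. i \<in> J \<Longrightarrow> t n i \<Longrightarrow> x n \<in> K closure_of U i"
    "\<And>n i. i \<in> J \<Longrightarrow> \<not> t n i \<Longrightarrow> x n \<in> K closure_of (topspace K - U i)"
proof -
  note m = law_props[OF \<nu>, of U, OF U]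
  \<comment> \<open>\<open>C (a, b)\<close> prescribes the pattern \<open>b\<close> on the indices
    in \<open>a\<close>. Avoiding the null sets of this form is exactly what makes every finite part
    of \<open>t n\<close> have positive measure; there are at most \<kappa> many.\<close>
  define C where "C = (\<lambda>(a, b). {t :: 'k \<times> nat \<Rightarrow> bool. \<forall>i\<in>a. t i \<longleftrightarrow> i \<in> b})"
  let ?F = "{a. finite a \<and> a \<subseteq> J}"
  define \<N>' where "\<N>' = {N \<in> C ` (?F \<times> ?F). N \<in> null_sets (law \<nu> U)}"
  have fin: "|?F| \<le>o \<kappa>" by (rule finite_subsets_ordLeq[OF Cinf J])
  have "|C ` (?F \<times> ?F)| \<le>o \<kappa>"
    by (rule card_image_ordLeq[OF Times_ordLeq[OF Cinf fin fin]])
  then have N': "|\<N>'| \<le>o \<kappa>"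
    unfolding \<N>'_def by (rule ordLeq_transitive[OF card_of_mono1, rotated]) auto
  have "|\<N> \<union> \<N>'| \<le>o \<kappa>"
    using N(2) N' Cinf by (intro card_of_Un_ordLeq_infinite_Field) (auto simp: cinfinite_def)
  moreover have "\<N> \<union> \<N>' \<subseteq> null_sets (law \<nu> U)" using N(1) by (auto simp: \<N>'_def)
  ultimately obtain t :: "nat \<Rightarrow> 'k \<times> nat \<Rightarrow> bool" where t: "\<And>n N. N \<in> \<N> \<union> \<N>' \<Longrightarrow> t n \<notin> N"
    "\<And>B. B \<in> \<B> \<Longrightarrow> \<exists>n. t n \<in> B"
    using exists_random_sequence[OF avoid Cinf m(1,2), of "\<N> \<union> \<N>'" \<B>] B m(2) by blast
  have "\<exists>x. x \<in> topspace K \<and> (\<forall>i\<in>J. t n i \<longrightarrow> x \<in> K closure_of U i) \<and>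
      (\<forall>i\<in>J. \<not> t n i \<longrightarrow> x \<in> K closure_of (topspace K - U i))" for n
  proof -
    have "emeasure \<nu> {x \<in> topspace K. \<forall>i\<in>a. x \<in> U i \<longleftrightarrow> t n i} > 0" if a: "finite a" "a \<subseteq> J" for a
    proof (rule ccontr)
      assume "\<not> ?thesis"
      then have 0: "emeasure \<nu> {x \<in> topspace K. \<forall>i\<in>a. x \<in> U i \<longleftrightarrow> t n i} = 0" by simp
      define b where "b = {i \<in> a. t n i}"
      have sC: "C (a, b) \<in> sets bits"
      proof -
        have "{t \<in> space bits. \<forall>i\<in>a. t i \<longleftrightarrow> i \<in> b} \<in> sets bits" using a(1) by measurable
        then show ?thesis by (simp add: C_def)
      qed
      have "{x \<in> topspace K. (\<lambda>i. x \<in> U i) \<in> C (a, b)} = {x \<in> topspace K. \<forall>i\<in>a. x \<in> U i \<longleftrightarrow> t n i}"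
        by (auto simp: C_def b_def)
      then have "emeasure (law \<nu> U) (C (a, b)) = 0" using m(3)[OF sC] 0 by simp
      then have "C (a, b) \<in> \<N>'"
        using a sC m(2) unfolding \<N>'_def null_sets_def by (auto simp: b_def)
      moreover have "t n \<in> C (a, b)" by (auto simp: C_def b_def)
      ultimately show False using t(1) by blast
    qed
    then show ?thesis
      by (rule compactness_point[OF \<nu>(2), of J U "t n"]) blast+
  qed
  from choice[OF allI[OF this]] obtain x where "\<forall>n. x n \<in> topspace K \<and> (\<forall>i\<in>J. t n i \<longrightarrow> x n \<in> K closure_of U i) \<and>
      (\<forall>i\<in>J. \<not> t n i \<longrightarrow> x n \<in> K closure_of (topspace K - U i))" ..
  then have x: "x n \<in> topspace K" "i \<in> J \<Longrightarrow> t n i \<Longrightarrow> x n \<in> K closure_of U i"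
    "i \<in> J \<Longrightarrow> \<not> t n i \<Longrightarrow> x n \<in> K closure_of (topspace K - U i)" for n i by blast+
  show thesis by (rule that[OF _ t(2) x]) (use t(1) in blast)
qed

end

subsection \<open>Shrinking neighbourhoods of small sets\<close>

context compact_radon
begin

lemma cond_props:
  assumes W: "W \<in> sets \<mu>" "emeasure \<mu> W > 0"
  shows "prob_space (uniform_measure \<mu> W)" "sets (uniform_measure \<mu> W) = sets \<mu>"
    "A \<in> sets \<mu> \<Longrightarrow> measure (uniform_measure \<mu> W) A = measure \<mu> (W \<inter> A) / measure \<mu> W"
  using W by (auto intro!: prob_space_uniform_measure measure_uniform_measure)

lemma measure_pos_iff: "emeasure \<mu> W > 0 \<longleftrightarrow> measure \<mu> W > 0"
  by (simp add: emeasure_eq_measure ennreal_less_zero_iff)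

text \<open>The complement of \<open>F\<close> is an open subset of \<open>W\<close>. Inner
  regularity exhausts it by a compact set up to \<open>e * measure \<mu> W\<close>, and
  \<open>V\<close> is the complement of that compact set.\<close>

lemma outer_open:
  assumes W: "W \<in> sets \<mu>" "emeasure \<mu> W > 0"
    and F: "closedin K F" "measure \<mu> (W \<inter> F) = 0" "topspace K - W \<subseteq> F" and e: "e > 0"
  obtains V where "openin K V" "F \<subseteq> V" "measure (uniform_measure \<mu> W) V < e"
proof -
  have pos: "measure \<mu> W > 0" using W(2) measure_pos_iff by simp
  define H where "H = topspace K - F"
  have H: "openin K H" unfolding H_def using F(1) by auto
  have F_sets: "F \<in> sets \<mu>" by (rule closed_sets[OF F(1)])
  have H_sets: "H \<in> sets \<mu>" by (rule open_sets[OF H])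
  have HW: "H \<subseteq> W" using F(3) by (auto simp: H_def)
  have "\<exists>C. compactin K C \<and> C \<subseteq> H \<and> measure \<mu> H - e * measure \<mu> W < measure \<mu> C"
  proof (cases "measure \<mu> H - e * measure \<mu> W < 0")
    \<comment> \<open>A negative bound would be lost in the passage to \<open>ennreal\<close>; here
      the empty set suffices.\<close>
    case True
    then show ?thesis by (intro exI[of _ "{}"]) simp
  next
    case False
    have "emeasure \<mu> H = (SUP C \<in> {C. compactin K C \<and> C \<subseteq> H}. emeasure \<mu> C)"
      using radon H_sets by (simp add: radon_measure_on_def)
    moreover have "ennreal (measure \<mu> H - e * measure \<mu> W) < emeasure \<mu> H"
      using False e pos by (simp add: emeasure_eq_measure ennreal_less_iff)
    ultimately have "\<exists>C\<in>{C. compactin K C \<and> C \<subseteq> H}. ennreal (measure \<mu> H - e * measure \<mu> W) < emeasure \<mu> C"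
      by (simp only: less_SUP_iff)
    then obtain C where "compactin K C" "C \<subseteq> H" "ennreal (measure \<mu> H - e * measure \<mu> W) < emeasure \<mu> C"
      by blast
    then show ?thesis
      using False by (intro exI[of _ C]) (simp add: emeasure_eq_measure ennreal_less_iff)
  qed
  then obtain C where C: "compactin K C" "C \<subseteq> H" "measure \<mu> H - e * measure \<mu> W < measure \<mu> C" by blast
  have C_closed: "closedin K C" by (rule compactin_imp_closedin[OF Hausdorff C(1)])
  have C_sets: "C \<in> sets \<mu>" by (rule closed_sets[OF C_closed])
  show thesis
  proof
    show V: "openin K (topspace K - C)" using C_closed by auto
    show "F \<subseteq> topspace K - C" using C(2) closedin_subset[OF F(1)] by (auto simp: H_def)
    have "measure \<mu> (W \<inter> (topspace K - C)) \<le> measure \<mu> ((W \<inter> F) \<union> (H - C))"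
      using W C_sets H_sets F_sets by (intro finite_measure_mono) (auto simp: H_def)
    also have "\<dots> \<le> measure \<mu> (W \<inter> F) + measure \<mu> (H - C)"
      using W C_sets H_sets F_sets by (intro measure_Un_le) auto
    also have "measure \<mu> (H - C) = measure \<mu> H - measure \<mu> C"
      by (rule finite_measure_Diff[OF H_sets C_sets C(2)])
    finally have "measure \<mu> (W \<inter> (topspace K - C)) < e * measure \<mu> W" using C(3) F(2) by simp
    then show "measure (uniform_measure \<mu> W) (topspace K - C) < e"
      using pos by (simp add: cond_props(3)[OF W open_sets[OF V]] divide_less_eq)
  qed
qed

text \<open>Otherwise every point has an open neighbourhood whose share of \<open>C k\<close> tends
  to 0. Finitely many of these cover K and their union inherits the property, but K takes all of
  each \<open>C k\<close>.\<close>

lemma exists_concentration_point: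
  fixes C :: "nat \<Rightarrow> 'a set"
  assumes \<nu>: "prob_space \<nu>" "sets \<nu> = sets \<mu>" and C: "\<And>k. C k \<in> sets \<mu>" "\<And>k. measure \<nu> (C k) > 0"
  shows "\<exists>d. d \<in> topspace K \<and> (\<forall>V. openin K V \<longrightarrow> d \<in> V \<longrightarrow>
    (\<exists>e>0. \<forall>n. \<exists>k\<ge>n. measure \<nu> (V \<inter> C k) > e * measure \<nu> (C k)))"
proof (rule ccontr)
  assume contr: "\<not> ?thesis"
  interpret \<nu>: prob_space \<nu> by fact
  define far where "far e n V \<longleftrightarrow> (\<exists>k\<ge>n. measure \<nu> (V \<inter> C k) > e * measure \<nu> (C k))" for e n V
  define negl where "negl V \<longleftrightarrow> \<not> (\<exists>e>0. \<forall>n. far e n V)" for V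
  have far_iff: "\<not> far e n V \<longleftrightarrow> (\<forall>k\<ge>n. measure \<nu> (V \<inter> C k) \<le> e * measure \<nu> (C k))" for e n V
    by (simp add: far_def not_less)
  have negl_iff: "negl V \<longleftrightarrow> (\<forall>e>0. \<exists>n. \<forall>k\<ge>n. measure \<nu> (V \<inter> C k) \<le> e * measure \<nu> (C k))" for V
    unfolding negl_def far_iff[symmetric] by blast
  have "\<forall>d. d \<in> topspace K \<longrightarrow> (\<exists>V. openin K V \<and> d \<in> V \<and> negl V)"
    using contr unfolding negl_def far_def by blast
  then have cover: "\<Union>{V. openin K V \<and> negl V} = topspace K"
    using openin_subset by fastforce
  obtain F where F: "finite F" "F \<subseteq> {V. openin K V \<and> negl V}" "\<Union>F = topspace K"
    using compact[unfolded compact_space, rule_format, of "{V. openin K V \<and> negl V}"] cover by auto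
  have "negl (\<Union>F) \<and> \<Union>F \<in> sets \<mu>"
    using F(1,2)
  proof (induction F)
    case empty
    then show ?case by (auto simp: negl_iff)
  next
    case (insert V F)
    have V: "V \<in> sets \<mu>" "negl V" using insert.prems open_sets by auto
    have UF: "\<Union>F \<in> sets \<mu>" "negl (\<Union>F)" using insert by auto
    have "negl (V \<union> \<Union>F)"
      unfolding negl_iff
    proof (intro allI impI)
      fix e :: real assume "e > 0"
      then obtain n1 n2 where n: "\<forall>k\<ge>n1. measure \<nu> (V \<inter> C k) \<le> e / 2 * measure \<nu> (C k)"
        "\<forall>k\<ge>n2. measure \<nu> (\<Union>F \<inter> C k) \<le> e / 2 * measure \<nu> (C k)"
        using V(2)[unfolded negl_iff, rule_format, of "e / 2"] UF(2)[unfolded negl_iff, rule_format, of "e / 2"] by auto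
      show "\<exists>n. \<forall>k\<ge>n. measure \<nu> ((V \<union> \<Union>F) \<inter> C k) \<le> e * measure \<nu> (C k)"
      proof (intro exI[of _ "max n1 n2"] allI impI)
        fix k assume k: "max n1 n2 \<le> k"
        have "(V \<union> \<Union>F) \<inter> C k = (V \<inter> C k) \<union> (\<Union>F \<inter> C k)" by auto
        then have "measure \<nu> ((V \<union> \<Union>F) \<inter> C k) \<le> measure \<nu> (V \<inter> C k) + measure \<nu> (\<Union>F \<inter> C k)"
          using V(1) UF(1) C(1) \<nu>(2) by (simp only:) (intro measure_Un_le, auto)
        moreover have "n1 \<le> k" "n2 \<le> k" using k by auto
        then have "measure \<nu> (V \<inter> C k) \<le> e / 2 * measure \<nu> (C k)"
          "measure \<nu> (\<Union>F \<inter> C k) \<le> e / 2 * measure \<nu> (C k)"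
          using n by blast+
        ultimately show "measure \<nu> ((V \<union> \<Union>F) \<inter> C k) \<le> e * measure \<nu> (C k)" by simp
      qed
    qed
    then show ?case using V UF by auto
  qed
  then have "negl (topspace K)" using F(3) by simp
  then have "\<exists>n. \<forall>k\<ge>n. measure \<nu> (topspace K \<inter> C k) \<le> 1/2 * measure \<nu> (C k)"
    unfolding negl_iff by (rule allE[of _ "1/2"]) simp
  then obtain n where "measure \<nu> (topspace K \<inter> C n) \<le> 1/2 * measure \<nu> (C n)" by blast
  moreover have "topspace K \<inter> C n = C n" using sets.sets_into_space[OF C(1)] by auto
  ultimately show False using C(2)[of n] by simp
qed

text \<open>
  \<open>G\<close> shrinks to the closure of \<open>\<kappa>\<close> many points that are chosen, by Lebesgue density for
  the partitions generated by \<open>A\<close>, so as to see every event in \<open>\<sigma>(A)\<close> of positive measure.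
\<close>
lemma exists_shrinking_neighbourhoods:
  fixes A :: "nat \<Rightarrow> 'a set"
  assumes W: "openin K W" "emeasure \<mu> W > 0"
    and small_null: "\<And>Z. Z \<subseteq> topspace K \<Longrightarrow> |Z| \<le>o \<kappa> \<Longrightarrow> measure \<mu> (W \<inter> K closure_of Z) = 0"
    and full: "\<And>m :: (nat \<Rightarrow> bool) measure. prob_space m \<Longrightarrow> sets m = sets bits \<Longrightarrow>
      \<exists>Y. |Y| \<le>o \<kappa> \<and> (\<forall>B\<in>sets m. emeasure m B > 0 \<longrightarrow> Y \<inter> B \<noteq> {})"
    and A: "\<And>i. A i \<in> sets \<mu>"
  defines "\<nu> \<equiv> uniform_measure \<mu> W"
  shows "\<exists>G :: nat \<Rightarrow> 'a set.
    (\<forall>k. openin K (G k) \<and> topspace K - W \<subseteq> G k \<and> K closure_of G (Suc k) \<subseteq> G k) \<and>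
    measure \<nu> (\<Inter>k. G k) = 0 \<and>
    (\<forall>E\<in>sigma_sets (topspace K) (range A). measure \<nu> E > 0 \<longrightarrow> (\<forall>k. measure \<nu> (E \<inter> G k) > 0))"
proof -
  note W_sets = open_sets[OF W(1)]
  note \<nu> = cond_props[OF W_sets W(2), folded \<nu>_def]
  interpret \<nu>: prob_space \<nu> by (rule \<nu>(1))
  define \<psi> where "\<psi> x = (\<lambda>i. x \<in> A i)" for x
  let ?m = "law \<nu> A"
  note m = law_props[OF \<nu>(1,2), of A, OF A, folded \<psi>_def]
  interpret m: prob_space ?m by (rule m(1))
  have m_meas: "measure ?m B = measure \<nu> {x \<in> topspace K. \<psi> x \<in> B}" if "B \<in> sets bits" for B
    using m(3)[OF that] by (simp add: m.emeasure_eq_measure \<nu>.emeasure_eq_measure)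
  have \<psi>_sets: "{x \<in> topspace K. \<psi> x \<in> B} \<in> sets \<mu>" if "B \<in> sets bits" for B
    using measurable_sets[OF measurable_indicators[OF refl, of A, OF A] that]
    by (simp add: \<psi>_def vimage_def Int_def conj_commute)
  obtain Y where Y: "|Y| \<le>o \<kappa>" "\<And>B. B \<in> sets ?m \<Longrightarrow> emeasure ?m B > 0 \<Longrightarrow> Y \<inter> B \<noteq> {}"
    using full[OF m(1,2)] by blast
  define C where "C k y = {x \<in> topspace K. \<psi> x \<in> cyl k y}" for k y
  have C_sets: "C k y \<in> sets \<mu>" for k y unfolding C_def by (rule \<psi>_sets) simp
  \<comment> \<open>Concentration points are available only where all cells have positive measure.
    The density points used below satisfy this, so none of them is lost.\<close>
  define Y' where "Y' = {y \<in> Y. \<forall>k. measure \<nu> (C k y) > 0}"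
  have "\<forall>y\<in>Y'. \<exists>d. d \<in> topspace K \<and>
      (\<forall>V. openin K V \<longrightarrow> d \<in> V \<longrightarrow> (\<exists>e>0. \<forall>n. \<exists>k\<ge>n. measure \<nu> (V \<inter> C k y) > e * measure \<nu> (C k y)))"
  proof
    fix y assume "y \<in> Y'"
    then have pos: "measure \<nu> (C k y) > 0" for k by (simp add: Y'_def)
    show "\<exists>d. d \<in> topspace K \<and>
      (\<forall>V. openin K V \<longrightarrow> d \<in> V \<longrightarrow> (\<exists>e>0. \<forall>n. \<exists>k\<ge>n. measure \<nu> (V \<inter> C k y) > e * measure \<nu> (C k y)))"
      by (rule exists_concentration_point[OF \<nu>(1,2), of "\<lambda>k. C k y", OF C_sets pos])
  qed
  from bchoice[OF this] obtain d where d: "\<forall>y\<in>Y'. d y \<in> topspace K \<and>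
      (\<forall>V. openin K V \<longrightarrow> d y \<in> V \<longrightarrow> (\<exists>e>0. \<forall>n. \<exists>k\<ge>n. measure \<nu> (V \<inter> C k y) > e * measure \<nu> (C k y)))" ..
  \<comment> \<open>The complement of \<open>W\<close> is \<nu>-null and can be added; it ensures
    that a point outside some \<open>G k\<close> lies in \<open>W\<close>.\<close>
  define F where "F = (topspace K - W) \<union> K closure_of (d ` Y')"
  have F_closed: "closedin K F" unfolding F_def using W(1) by (intro closedin_Un) auto
  have dY: "d ` Y' \<subseteq> topspace K" using d by auto
  have dF: "d y \<in> F" if "y \<in> Y'" for y
    using closure_of_subset[OF dY] that by (auto simp: F_def)
  have "|d ` Y'| \<le>o \<kappa>"
    by (intro card_image_ordLeq ordLeq_transitive[OF card_of_mono1 Y(1)]) (auto simp: Y'_def)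
  moreover have "W \<inter> F = W \<inter> K closure_of (d ` Y')" by (auto simp: F_def)
  ultimately have F_null: "measure \<mu> (W \<inter> F) = 0"
    using small_null[OF dY] by simp
  have outer: "\<exists>V. openin K V \<and> F \<subseteq> V \<and> measure \<nu> V < e" if e: "e > 0" for e
  proof -
    have "topspace K - W \<subseteq> F" by (simp add: F_def)
    from outer_open[OF W_sets W(2) F_closed F_null this e] show ?thesis unfolding \<nu>_def by blast
  qed
  define P where "P k G \<longleftrightarrow> openin K G \<and> F \<subseteq> G \<and> measure \<nu> G < inverse (real (Suc k))" for k G
  have "\<exists>G. \<forall>k. P k (G k) \<and> K closure_of G (Suc k) \<subseteq> G k"
  proof (rule dependent_nat_choice)
    show "\<exists>G. P 0 G" unfolding P_def by (rule outer) simp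
    fix G k assume G: "P k G"
    obtain V where V: "openin K V" "F \<subseteq> V" "measure \<nu> V < inverse (real (Suc (Suc k)))"
      using outer[of "inverse (real (Suc (Suc k)))"] by auto
    have GV: "openin K (G \<inter> V)" "F \<subseteq> G \<inter> V" using G V by (auto simp: P_def)
    obtain U where U: "openin K U" "F \<subseteq> U" "K closure_of U \<subseteq> G \<inter> V"
      by (rule normal_space_shrink[OF normal F_closed GV])
    have "U \<subseteq> V" using U(3) closure_of_subset[OF openin_subset[OF U(1)]] by blast
    then have "measure \<nu> U \<le> measure \<nu> V"
      using open_sets[OF V(1)] by (intro \<nu>.finite_measure_mono) (auto simp: \<nu>(2))
    then show "\<exists>U. P (Suc k) U \<and> K closure_of U \<subseteq> G"
      using U V(3) by (intro exI[of _ U]) (auto simp: P_def)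
  qed
  then obtain G where G: "\<And>k. P k (G k)" "\<And>k. K closure_of G (Suc k) \<subseteq> G k" by blast
  have G_open: "openin K (G k)" and FG: "F \<subseteq> G k" for k using G(1)[of k] by (auto simp: P_def)
  have G_sets: "G k \<in> sets \<mu>" for k by (rule open_sets[OF G_open])
  have "measure \<nu> (\<Inter>k. G k) = 0"
  proof -
    have "measure \<nu> (\<Inter>k. G k) \<le> inverse (real (Suc k))" for k
    proof -
      have "measure \<nu> (\<Inter>k. G k) \<le> measure \<nu> (G k)"
        using G_sets by (intro \<nu>.finite_measure_mono) (auto simp: \<nu>(2))
      then show ?thesis using G(1)[of k] by (simp add: P_def)
    qed
    then have "measure \<nu> (\<Inter>k. G k) \<le> 0"
      by (intro LIMSEQ_le_const[OF LIMSEQ_inverse_real_of_nat]) auto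
    then show ?thesis by (simp add: measure_le_0_iff)
  qed
  moreover have "measure \<nu> (E \<inter> G k) > 0"
    if E: "E \<in> sigma_sets (topspace K) (range A)" "measure \<nu> E > 0" for E k
  proof (rule ccontr)
    assume "\<not> measure \<nu> (E \<inter> G k) > 0"
    then have 0: "measure \<nu> (E \<inter> G k) = 0" by (simp add: measure_le_0_iff not_less)
    have "\<exists>B\<in>sets bits. E = {x \<in> topspace K. \<psi> x \<in> B}"
      using E(1)
    proof induction
      case (Basic a)
      then obtain i where i: "a = A i" by blast
      have "{t \<in> space bits. t i} \<in> sets (bits :: (nat \<Rightarrow> bool) measure)" by measurable
      moreover have "a \<subseteq> topspace K" using sets.sets_into_space[OF A[of i]] i by simp
      ultimately show ?case
        by (intro bexI[of _ "{t. t i}"]) (auto simp: i \<psi>_def)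
    next
      case Empty
      show ?case by (intro bexI[of _ "{}"]) auto
    next
      case (Compl a)
      then obtain B where B: "B \<in> sets bits" "a = {x \<in> topspace K. \<psi> x \<in> B}" by blast
      have "UNIV - B \<in> sets bits" using sets.compl_sets[OF B(1)] by simp
      then show ?case by (rule rev_bexI) (auto simp: B(2))
    next
      case (Union a)
      from Union.IH have "\<forall>i. \<exists>B. B \<in> sets bits \<and> a i = {x \<in> topspace K. \<psi> x \<in> B}" by blast
      from choice[OF this] obtain B
        where B: "\<forall>i. B i \<in> sets bits \<and> a i = {x \<in> topspace K. \<psi> x \<in> B i}" ..
      then have "(\<Union>i. B i) \<in> sets bits" by (intro sets.countable_UN) auto
      then show ?case by (rule rev_bexI) (use B in auto)
    qed
    then obtain B where B: "B \<in> sets bits" and EB: "E = {x \<in> topspace K. \<psi> x \<in> B}" by blast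
    have "measure ?m B > 0" using E(2) m_meas[OF B] EB by simp
    moreover have "B \<in> sets ?m" using B m(2) by simp
    ultimately obtain B' where B': "B' \<in> sets ?m" "emeasure ?m B' > 0"
      "\<And>y k. y \<in> B' \<Longrightarrow> measure ?m (cyl k y) > 0"
      "\<And>y e. y \<in> B' \<Longrightarrow> e > 0 \<Longrightarrow> \<exists>n. \<forall>k\<ge>n. measure ?m (cyl k y - B) \<le> e * measure ?m (cyl k y)"
      using cylinder_density[OF m.finite_measure_axioms m(2), of B] by blast
    obtain y where y: "y \<in> Y" "y \<in> B'" using Y(2)[OF B'(1,2)] by blast
    have mC: "measure ?m (cyl j y) = measure \<nu> (C j y)" for j
      unfolding C_def by (rule m_meas) simp
    have y': "y \<in> Y'" using y(1) B'(3)[OF y(2)] by (simp add: Y'_def mC)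
    have "d y \<in> G k" using dF[OF y'] FG by blast
    then obtain e where e: "e > 0" "\<forall>n. \<exists>j\<ge>n. measure \<nu> (G k \<inter> C j y) > e * measure \<nu> (C j y)"
      using bspec[OF d y', THEN conjunct2, rule_format, OF G_open] by blast
    obtain n where n: "\<forall>j\<ge>n. measure ?m (cyl j y - B) \<le> e * measure ?m (cyl j y)"
      using B'(4)[OF y(2) e(1)] by blast
    obtain j where j: "j \<ge> n" "measure \<nu> (G k \<inter> C j y) > e * measure \<nu> (C j y)" using e(2) by blast
    have E_sets: "E \<in> sets \<mu>" unfolding EB by (rule \<psi>_sets[OF B])
    \<comment> \<open>At level \<open>j\<close>, the set \<open>G k\<close> takes more than the
      fraction \<open>e\<close> of the cell \<open>C j y\<close>, while \<open>E\<close> misses at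
      most that fraction of it; so the two overlap in positive measure.\<close>
    have "measure \<nu> (G k \<inter> C j y) \<le> measure \<nu> ((E \<inter> G k) \<union> (C j y - E))"
      using G_sets C_sets E_sets by (intro \<nu>.finite_measure_mono) (auto simp: \<nu>(2))
    also have "\<dots> \<le> measure \<nu> (E \<inter> G k) + measure \<nu> (C j y - E)"
      using G_sets C_sets E_sets by (intro measure_Un_le) (auto simp: \<nu>(2))
    also have "C j y - E = {x \<in> topspace K. \<psi> x \<in> cyl j y - B}" by (auto simp: C_def EB)
    also have "measure \<nu> \<dots> = measure ?m (cyl j y - B)"
      by (rule m_meas[symmetric]) (use B in auto)
    also have "\<dots> \<le> e * measure \<nu> (C j y)" using n j(1) mC by simp
    finally show False using 0 j(2) by simp
  qed
  moreover have "topspace K - W \<subseteq> G k" for k using FG[of k] by (auto simp: F_def)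
  ultimately show ?thesis using G_open G(2) by (intro exI[of _ G]) blast
qed

end

subsection \<open>Separability\<close>

lemma Cinfinite_omega1: "Cinfinite omega1"
  unfolding omega1_def by (intro Cinfinite_cardSuc) (simp add: natLeq_Cinfinite)

lemma le_natLeq_imp_countable:
  assumes "|A| \<le>o natLeq" shows "countable A"
proof -
  have "|A| \<le>o |UNIV :: nat set|"
    by (rule ordLeq_ordIso_trans[OF assms ordIso_symmetric[OF card_of_nat]])
  then obtain f :: "'a \<Rightarrow> nat" where "inj_on f A"
    unfolding card_of_ordLeq[symmetric] by blast
  then show ?thesis by (rule countableI)
qed

lemma countable_underS_omega1: "countable (underS omega1 \<zeta>)"
proof (cases "\<zeta> \<in> Field omega1")
  case True
  have "|underS omega1 \<zeta>| <o omega1"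
    using Cinfinite_omega1 True by (intro card_of_underS) auto
  then have "|underS omega1 \<zeta>| \<le>o natLeq"
    unfolding omega1_def by (simp add: cardSuc_ordLeq_ordLess natLeq_Card_order card_of_Card_order)
  then show ?thesis by (rule le_natLeq_imp_countable)
next
  case False
  then have "underS omega1 \<zeta> = {}" by (auto simp: underS_def Field_def)
  then show ?thesis by simp
qed

text \<open>If \<open>S\<close> were unbounded, the countable segments up to its elements would
  cover \<open>omega1\<close>, making it a countable union of countable sets.\<close>

lemma countable_bounded_omega1:
  assumes S: "countable S" "S \<subseteq> Field omega1"
  obtains \<zeta> where "\<zeta> \<in> Field omega1" "S \<subseteq> underS omega1 \<zeta>"
proof -
  have card: "Card_order omega1" using Cinfinite_omega1 by simp
  have wo: "well_order_on (Field omega1) omega1" using card by (simp add: card_order_on_def)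
  have "\<exists>\<zeta>\<in>Field omega1. S \<subseteq> underS omega1 \<zeta>"
  proof (rule ccontr)
    assume n: "\<not> ?thesis"
    have "Field omega1 \<subseteq> (\<Union>\<xi>\<in>S. insert \<xi> (underS omega1 \<xi>))"
    proof
      fix \<zeta> assume \<zeta>: "\<zeta> \<in> Field omega1"
      with n obtain \<xi> where \<xi>: "\<xi> \<in> S" "\<xi> \<notin> underS omega1 \<zeta>" by blast
      have "\<xi> = \<zeta> \<or> (\<zeta>, \<xi>) \<in> omega1 \<or> (\<xi>, \<zeta>) \<in> omega1"
        using wo \<zeta> \<xi>(1) S(2) unfolding well_order_on_def linear_order_on_def total_on_def by blast
      then show "\<zeta> \<in> (\<Union>\<xi>\<in>S. insert \<xi> (underS omega1 \<xi>))"
        using \<xi> by (auto simp: underS_def)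
    qed
    then have "countable (Field omega1)"
      by (rule countable_subset) (use S(1) countable_underS_omega1 in auto)
    then have "|Field omega1| \<le>o natLeq"
      by (rule countable_ordLeq) (simp add: natLeq_Cinfinite)
    then have "omega1 \<le>o natLeq"
      using ordIso_ordLeq_trans[OF ordIso_symmetric[OF card_of_Field_ordIso[OF card]]] by blast
    moreover have "natLeq <o omega1"
      unfolding omega1_def by (rule cardSuc_greater[OF natLeq_Card_order])
    ultimately show False using not_ordLess_ordLeq by blast
  qed
  then show thesis using that by blast
qed

text \<open>\<open>avoid\<close> and \<open>full\<close> are the forms in which cov and non enter.
  Since \<open>omega1\<close> is an order on \<open>nat set\<close>, its elements can serve directly
  as the stages in the index type.\<close>

locale strictly_positive_radon = compact_radon_random K \<mu> omega1
  for K :: "'a topology" and \<mu> :: "'a measure" +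
  assumes full: "\<And>m :: (nat \<Rightarrow> bool) measure. prob_space m \<Longrightarrow> sets m = sets bits \<Longrightarrow>
      \<exists>Y. |Y| \<le>o omega1 \<and> (\<forall>B\<in>sets m. emeasure m B > 0 \<longrightarrow> Y \<inter> B \<noteq> {})"
    and positive: "\<And>U. openin K U \<Longrightarrow> U \<noteq> {} \<Longrightarrow> emeasure \<mu> U > 0"
    and pi_character: "countable_pi_character K"
begin

text \<open>A random sequence has, for every \<open>P\<close>, an entry whose bit for
  \<open>V P\<close> is true. The point made from this entry is only known to lie in the closure of
  \<open>V P\<close>, hence the choice of \<open>V P\<close> with closure inside
  \<open>P\<close>.\<close>

lemma countable_hitting_set:
  assumes \<P>: "\<And>P. P \<in> \<P> \<Longrightarrow> openin K P \<and> P \<noteq> {}" "|\<P>| \<le>o omega1"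
  obtains D where "countable D" "D \<subseteq> topspace K" "\<And>P. P \<in> \<P> \<Longrightarrow> D \<inter> P \<noteq> {}"
proof (cases "\<P> = {}")
  case True
  then show ?thesis by (intro that[of "{}"]) auto
next
  case False
  then obtain P0 where P0: "openin K P0" "P0 \<noteq> {}" using \<P>(1) by blast
  then have "topspace K \<noteq> {}" using openin_subset by blast
  then have pos: "emeasure \<mu> (topspace K) > 0" by (intro positive) auto
  have top_sets: "topspace K \<in> sets \<mu>" by (intro open_sets) auto
  note \<nu> = cond_props[OF top_sets pos]
  interpret \<nu>: prob_space "uniform_measure \<mu> (topspace K)" by (rule \<nu>(1))
  \<comment> \<open>Indices have to come from \<open>nat set\<close>, so the members of
    \<open>\<P>\<close> are coded by sets of naturals.\<close>
  have "|\<P>| \<le>o |UNIV :: nat set set|"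
    using ordLeq_transitive[OF ordLeq_ordIso_trans[OF \<P>(2) ordIso_symmetric[OF card_of_Field_ordIso]] card_of_mono1]
      Cinfinite_omega1 by blast
  then obtain f :: "'a set \<Rightarrow> nat set" where f: "inj_on f \<P>"
    unfolding card_of_ordLeq[symmetric] by blast
  have "\<forall>P\<in>\<P>. \<exists>V. openin K V \<and> V \<noteq> {} \<and> K closure_of V \<subseteq> P"
  proof
    fix P assume "P \<in> \<P>"
    with \<P>(1) obtain p where "openin K P" "p \<in> P" by blast
    then show "\<exists>V. openin K V \<and> V \<noteq> {} \<and> K closure_of V \<subseteq> P"
      using regular_space_shrink[OF regular] by (metis empty_iff)
  qed
  from bchoice[OF this] obtain V
    where V: "\<forall>P\<in>\<P>. openin K (V P) \<and> V P \<noteq> {} \<and> K closure_of V P \<subseteq> P" ..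
  define U where "U = (\<lambda>(s, n :: nat). if s \<in> f ` \<P> then V (inv_into \<P> f s) else {})"
  have U_f: "U (f P, n) = V P" if "P \<in> \<P>" for P n
    using that f by (simp add: U_def)
  have U_sets: "U i \<in> sets \<mu>" for i
    using V by (cases i) (auto simp: U_def inv_into_into intro!: open_sets)
  define J where "J = (\<lambda>P. (f P, 0 :: nat)) ` \<P>"
  have J: "|J| \<le>o omega1" unfolding J_def by (rule card_image_ordLeq[OF \<P>(2)])
  define \<B> where "\<B> = (\<lambda>P. {t :: nat set \<times> nat \<Rightarrow> bool. t (f P, 0)}) ` \<P>"
  have \<B>: "|\<B>| \<le>o omega1" unfolding \<B>_def by (rule card_image_ordLeq[OF \<P>(2)])
  have \<B>_pos: "B \<in> sets bits \<and> emeasure (law (uniform_measure \<mu> (topspace K)) U) B > 0" if B_mem: "B \<in> \<B>" for B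
  proof -
    obtain P where P: "P \<in> \<P>" "B = {t. t (f P, 0)}" using B_mem by (auto simp: \<B>_def)
    have "{t \<in> space bits. t (f P, 0)} \<in> sets (bits :: (nat set \<times> nat \<Rightarrow> bool) measure)" by measurable
    then have B: "B \<in> sets bits" using P(2) by simp
    have VP: "openin K (V P)" "V P \<noteq> {}" using V P(1) by auto
    have "{x \<in> topspace K. (\<lambda>i. x \<in> U i) \<in> B} = V P"
      using openin_subset[OF VP(1)] by (auto simp: P(2) U_f[OF P(1)])
    moreover have "emeasure (uniform_measure \<mu> (topspace K)) (V P) > 0"
    proof -
      have "topspace K \<inter> V P = V P" using openin_subset[OF VP(1)] by auto
      moreover have "measure \<mu> (V P) > 0" "measure \<mu> (topspace K) > 0"
        using positive[OF VP] pos measure_pos_iff by auto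
      ultimately show ?thesis
        by (simp add: \<nu>.emeasure_eq_measure \<nu>(3)[OF open_sets[OF VP(1)]] ennreal_less_zero_iff)
    qed
    ultimately show ?thesis
      using law_props(3)[OF \<nu>(1,2), of U, OF U_sets B] B by simp
  qed
  obtain t :: "nat \<Rightarrow> nat set \<times> nat \<Rightarrow> bool" and x
    where t: "\<And>B. B \<in> \<B> \<Longrightarrow> \<exists>n. t n \<in> B" and x: "\<And>n. x n \<in> topspace K"
      "\<And>n i. i \<in> J \<Longrightarrow> t n i \<Longrightarrow> x n \<in> K closure_of U i"
    using exists_random_points[OF \<nu>(1,2), of U J "{}" \<B>, OF U_sets J _ _ \<B>_pos \<B>]
      countable_ordLeq[OF _ Cinfinite_omega1] by (metis countable_empty empty_subsetI)
  show thesis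
  proof (rule that[of "range x"])
    show "range x \<inter> P \<noteq> {}" if P: "P \<in> \<P>" for P
    proof -
      obtain n where "t n (f P, 0)" using t[of "{t. t (f P, 0)}"] P by (auto simp: \<B>_def)
      then have "x n \<in> K closure_of V P"
        using x(2)[of "(f P, 0)" n] P by (auto simp: J_def U_f)
      then show ?thesis using V P by blast
    qed
  qed (use x in auto)
qed

text \<open>Countable \<pi>-bases at the points of \<open>Z\<close> have together at most
  \<open>omega1\<close> members, and a set meeting all of them has every point of \<open>Z\<close>
  in its closure.\<close>

lemma small_subset_closure:
  assumes Z: "Z \<subseteq> topspace K" "|Z| \<le>o omega1"
  obtains D where "countable D" "D \<subseteq> topspace K" "Z \<subseteq> K closure_of D"
proof -
  have "\<forall>z\<in>Z. \<exists>\<P>. countable \<P> \<and> pi_base_at K z \<P>"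
    using pi_character Z(1) by (auto simp: countable_pi_character_def)
  from bchoice[OF this] obtain \<P> where \<P>: "\<forall>z\<in>Z. countable (\<P> z) \<and> pi_base_at K z (\<P> z)" ..
  have "|\<Union>z\<in>Z. \<P> z| \<le>o omega1"
    by (rule UNION_ordLeq[OF Cinfinite_omega1 Z(2) countable_ordLeq[OF _ Cinfinite_omega1]]) (use \<P> in blast)
  then obtain D where D: "countable D" "D \<subseteq> topspace K" "\<And>P. P \<in> (\<Union>z\<in>Z. \<P> z) \<Longrightarrow> D \<inter> P \<noteq> {}"
    using countable_hitting_set[of "\<Union>z\<in>Z. \<P> z"] \<P> unfolding pi_base_at_def by (metis UN_E)
  have "Z \<subseteq> K closure_of D"
  proof
    fix z assume z: "z \<in> Z"
    have "\<exists>y. y \<in> D \<and> y \<in> V" if V: "z \<in> V" "openin K V" for V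
    proof -
      obtain P where "P \<in> \<P> z" "P \<subseteq> V" using \<P> z V unfolding pi_base_at_def by blast
      then show ?thesis using D(3)[of P] z by blast
    qed
    then show "z \<in> K closure_of D" using z Z(1) by (auto simp: in_closure_of)
  qed
  with D(1,2) show thesis using that by blast
qed

text \<open>The supremum is attained because countably many nearly optimal sets can be
  united.\<close>

lemma exists_countable_maximal_closure:
  obtains D where "countable D" "D \<subseteq> topspace K"
    "\<And>D'. countable D' \<Longrightarrow> D' \<subseteq> topspace K \<Longrightarrow> measure \<mu> (K closure_of D') \<le> measure \<mu> (K closure_of D)"
proof -
  define M where "M = {measure \<mu> (K closure_of D) | D. countable D \<and> D \<subseteq> topspace K}"
  have M_ne: "M \<noteq> {}" unfolding M_def by (auto intro: exI[of _ "{}"])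
  have M_bdd: "bdd_above M" unfolding M_def by (auto intro!: bdd_aboveI[of _ "measure \<mu> (space \<mu>)"] bounded_measure)
  have "\<exists>D. countable D \<and> D \<subseteq> topspace K \<and> Sup M - inverse (real (Suc n)) < measure \<mu> (K closure_of D)" for n
  proof -
    have "Sup M - inverse (real (Suc n)) < Sup M" by simp
    from less_cSupD[OF M_ne this] show ?thesis unfolding M_def by blast
  qed
  then have "\<forall>n. \<exists>D. countable D \<and> D \<subseteq> topspace K \<and> Sup M - inverse (real (Suc n)) < measure \<mu> (K closure_of D)" by blast
  from choice[OF this] obtain D
    where D: "\<forall>n. countable (D n) \<and> D n \<subseteq> topspace K \<and> Sup M - inverse (real (Suc n)) < measure \<mu> (K closure_of D n)" ..
  have "measure \<mu> (K closure_of D n) \<le> measure \<mu> (K closure_of (\<Union>n. D n))" for n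
    by (intro finite_measure_mono closure_of_mono closed_sets) auto
  then have "Sup M - inverse (real (Suc n)) \<le> measure \<mu> (K closure_of (\<Union>n. D n))" for n
    using D by (meson less_le_trans less_imp_le)
  moreover have "(\<lambda>n. Sup M - inverse (real (Suc n))) \<longlonglongrightarrow> Sup M - 0"
    by (intro tendsto_diff tendsto_const LIMSEQ_inverse_real_of_nat)
  ultimately have "Sup M \<le> measure \<mu> (K closure_of (\<Union>n. D n))"
    by (intro LIMSEQ_le_const2[of _ "Sup M"]) auto
  then have max: "measure \<mu> (K closure_of D') \<le> measure \<mu> (K closure_of (\<Union>n. D n))"
    if "countable D'" "D' \<subseteq> topspace K" for D'
    using cSup_upper[OF _ M_bdd, of "measure \<mu> (K closure_of D')"] that unfolding M_def by fastforce
  show thesis by (rule that[of "\<Union>n. D n"]) (use D max in auto)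
qed

text \<open>
  If no countable set were dense, let \<open>W\<close> be the complement of a closure of maximal measure, and build
  families \<open>U \<zeta>\<close> of shrinking neighbourhoods along \<open>\<omega>\<^sub>1\<close>, each for the events generated by the earlier ones.
  A random point \<open>x\<close> avoids every \<open>\<Inter>k. U \<zeta> k\<close>. The hulls of the members of a countable \<open>\<pi>\<close>-base at \<open>x\<close>
  are all generated before some stage \<open>\<zeta>\<close>, hence all meet \<open>U \<zeta> k\<close>, whereas some member of the \<open>\<pi>\<close>-base avoids it.
\<close>
theorem separable:
  obtains D where "countable D" "D \<subseteq> topspace K" "K closure_of D = topspace K"
proof -
  obtain D where D: "countable D" "D \<subseteq> topspace K"
    and D_max: "\<And>D'. countable D' \<Longrightarrow> D' \<subseteq> topspace K \<Longrightarrow> measure \<mu> (K closure_of D') \<le> measure \<mu> (K closure_of D)"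
    using exists_countable_maximal_closure by blast
  have "K closure_of D = topspace K"
  proof (rule ccontr)
    assume not_dense: "K closure_of D \<noteq> topspace K"
    define W where "W = topspace K - K closure_of D"
    have W: "openin K W" unfolding W_def by auto
    have "W \<noteq> {}" using not_dense closure_of_subset_topspace[of K D] by (auto simp: W_def)
    then have W_pos: "emeasure \<mu> W > 0" by (rule positive[OF W])
    define \<nu> where "\<nu> = uniform_measure \<mu> W"
    note \<nu> = cond_props[OF open_sets[OF W] W_pos, folded \<nu>_def]
    interpret \<nu>: prob_space \<nu> by (rule \<nu>(1))
    \<comment> \<open>A countable \<open>D'\<close> with \<open>Z\<close> in its closure can be
      added to \<open>D\<close>; by maximality this gains no measure on \<open>W\<close>.\<close>
    have small_null: "measure \<mu> (W \<inter> K closure_of Z) = 0" if Z: "Z \<subseteq> topspace K" "|Z| \<le>o omega1" for Z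
    proof -
      obtain D' where D': "countable D'" "D' \<subseteq> topspace K" "Z \<subseteq> K closure_of D'"
        using small_subset_closure[OF Z] by blast
      have sets: "K closure_of D' \<in> sets \<mu>" "K closure_of D \<in> sets \<mu>" "K closure_of Z \<in> sets \<mu>" "W \<in> sets \<mu>"
        using W by (auto intro: closed_sets open_sets)
      have "K closure_of Z \<subseteq> K closure_of D'"
        using D'(3) by (rule closure_of_minimal) auto
      then have "(W \<inter> K closure_of Z) \<union> K closure_of D \<subseteq> K closure_of (D \<union> D')"
        by (auto simp: closure_of_Un)
      then have "measure \<mu> ((W \<inter> K closure_of Z) \<union> K closure_of D) \<le> measure \<mu> (K closure_of (D \<union> D'))"
        by (intro finite_measure_mono closed_sets) auto
      also have "\<dots> \<le> measure \<mu> (K closure_of D)"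
        using D D' by (intro D_max) auto
      finally have "measure \<mu> ((W \<inter> K closure_of Z) \<union> K closure_of D) \<le> measure \<mu> (K closure_of D)" .
      moreover have "measure \<mu> ((W \<inter> K closure_of Z) \<union> K closure_of D) =
          measure \<mu> (W \<inter> K closure_of Z) + measure \<mu> (K closure_of D)"
        using sets by (intro finite_measure_Union) (auto simp: W_def)
      ultimately show ?thesis by (simp add: measure_le_0_iff)
    qed
    define good where "good A G \<longleftrightarrow>
      (\<forall>k. openin K (G k) \<and> topspace K - W \<subseteq> G k \<and> K closure_of G (Suc k) \<subseteq> G k) \<and>
      measure \<nu> (\<Inter>k. G k) = 0 \<and>
      (\<forall>E\<in>sigma_sets (topspace K) (range A). measure \<nu> E > 0 \<longrightarrow> (\<forall>k. measure \<nu> (E \<inter> G k) > 0))"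
      for A G :: "nat \<Rightarrow> 'a set"
    have ex_good: "\<exists>G. good A G" if "\<And>i. A i \<in> sets \<mu>" for A
      unfolding good_def \<nu>_def
      by (rule exists_shrinking_neighbourhoods[OF W W_pos small_null full that])
    define lt where "lt = omega1 - Id"
    have lt_iff: "(\<xi>, \<zeta>) \<in> lt \<longleftrightarrow> \<xi> \<in> underS omega1 \<zeta>" for \<xi> \<zeta> by (auto simp: lt_def underS_def)
    have wo: "well_order_on (Field omega1) omega1"
      using Cinfinite_omega1 by (simp add: card_order_on_def)
    have wf: "wf lt" using wo by (simp add: lt_def well_order_on_def)
    have "trans omega1"
      using wo by (auto simp: well_order_on_def linear_order_on_def partial_order_on_def preorder_on_def)
    have "antisym omega1"
      using wo by (auto simp: well_order_on_def linear_order_on_def partial_order_on_def)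
    have underS_trans: "underS omega1 \<xi> \<subseteq> underS omega1 \<zeta>" if "\<xi> \<in> underS omega1 \<zeta>" for \<xi> \<zeta>
      using that \<open>trans omega1\<close> \<open>antisym omega1\<close> unfolding underS_def trans_def antisym_def by blast
    \<comment> \<open>\<open>good\<close> expects a single sequence of events, so pairs of an
      earlier stage and a level are enumerated; initial segments of \<open>omega1\<close> are
      countable.\<close>
    define e where "e \<zeta> = from_nat_into (underS omega1 \<zeta> \<times> (UNIV :: nat set))" for \<zeta>
    \<comment> \<open>The guard restricts the recursion to earlier stages and supplies the empty set
      when there are none, where \<open>e\<close> lists nothing meaningful.\<close>
    define earlier where "earlier F \<zeta> n = (if (fst (e \<zeta> n), \<zeta>) \<in> lt then F (fst (e \<zeta> n)) (snd (e \<zeta> n)) else {})"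
      for F :: "nat set \<Rightarrow> nat \<Rightarrow> 'a set" and \<zeta> n
    define U where "U = wfrec lt (\<lambda>F \<zeta>. SOME G. good (earlier F \<zeta>) G)"
    have U_rec: "U \<zeta> = (SOME G. good (earlier U \<zeta>) G)" for \<zeta>
    proof -
      have "earlier (cut U lt \<zeta>) \<zeta> = earlier U \<zeta>"
        by (auto simp: earlier_def cut_def fun_eq_iff)
      then show ?thesis unfolding U_def by (subst wfrec[OF wf]) simp
    qed
    have good: "good (earlier U \<zeta>) (U \<zeta>)" for \<zeta>
      using wf
    proof (induction \<zeta> rule: wf_induct_rule)
      case (less \<zeta>)
      have "earlier U \<zeta> n \<in> sets \<mu>" for n
        using less[of "fst (e \<zeta> n)"] by (auto simp: earlier_def good_def intro!: open_sets)
      from someI_ex[OF ex_good[of "earlier U \<zeta>", OF this]] show ?case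
        by (simp only: U_rec[of \<zeta>, symmetric])
    qed
    have U_open: "openin K (U \<zeta> k)" and U_W: "topspace K - W \<subseteq> U \<zeta> k"
      and U_Suc: "K closure_of U \<zeta> (Suc k) \<subseteq> U \<zeta> k" and U_null: "measure \<nu> (\<Inter>k. U \<zeta> k) = 0" for \<zeta> k
      using good[of \<zeta>] unfolding good_def by blast+
    have U_meets: "measure \<nu> (E \<inter> U \<zeta> k) > 0"
      if "E \<in> sigma_sets (topspace K) (range (earlier U \<zeta>))" "measure \<nu> E > 0" for E \<zeta> k
      using good[of \<zeta>] that unfolding good_def by blast
    have U_sets: "U \<zeta> k \<in> sets \<mu>" for \<zeta> k by (rule open_sets[OF U_open])
    define \<Sigma> where "\<Sigma> \<zeta> = sigma_sets (topspace K) {U \<xi> k | \<xi> k. \<xi> \<in> underS omega1 \<zeta>}" for \<zeta>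
    have \<Sigma>_mono: "\<Sigma> \<xi> \<subseteq> \<Sigma> \<zeta>" if "\<xi> \<in> underS omega1 \<zeta>" for \<xi> \<zeta>
      unfolding \<Sigma>_def using underS_trans[OF that] by (intro sigma_sets_subseteq) auto
    have \<Sigma>_sets: "\<Sigma> \<zeta> \<subseteq> sets \<mu>" for \<zeta>
      unfolding \<Sigma>_def space_mu[symmetric] by (rule sets.sigma_sets_subset) (use U_sets in auto)
    have \<Sigma>_earlier: "\<Sigma> \<zeta> \<subseteq> sigma_sets (topspace K) (range (earlier U \<zeta>))" for \<zeta>
      unfolding \<Sigma>_def
    proof (rule sigma_sets_subseteq, safe)
      fix \<xi> k assume \<xi>: "\<xi> \<in> underS omega1 \<zeta>"
      have "range (e \<zeta>) = underS omega1 \<zeta> \<times> UNIV"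
        unfolding e_def using \<xi> countable_underS_omega1 by (intro range_from_nat_into) auto
      then obtain n where "e \<zeta> n = (\<xi>, k)" using \<xi> by (metis SigmaI UNIV_I imageE)
      then have "U \<xi> k = earlier U \<zeta> n" using \<xi> by (simp add: earlier_def lt_iff)
      then show "U \<xi> k \<in> range (earlier U \<zeta>)" by simp
    qed
    \<comment> \<open>The \<Sigma> \<zeta> increase, and countably many stages have a common
      bound.\<close>
    have \<Sigma>_common: "\<exists>\<zeta>\<in>Field omega1. \<forall>i\<in>I. E i \<in> \<Sigma> \<zeta>"
      if I: "countable I" "\<forall>i\<in>I. \<exists>\<zeta>\<in>Field omega1. E i \<in> \<Sigma> \<zeta>" for I :: "'b set" and E
    proof -
      from bchoice[of I "\<lambda>i \<zeta>. \<zeta> \<in> Field omega1 \<and> E i \<in> \<Sigma> \<zeta>"] I(2)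
      obtain z where z: "\<forall>i\<in>I. z i \<in> Field omega1 \<and> E i \<in> \<Sigma> (z i)" by blast
      obtain \<zeta> where "\<zeta> \<in> Field omega1" "z ` I \<subseteq> underS omega1 \<zeta>"
        by (rule countable_bounded_omega1[of "z ` I"]) (use I(1) z in auto)
      then show ?thesis using z \<Sigma>_mono by blast
    qed
    \<comment> \<open>A minimising sequence is countable and thus lies in one \<Sigma> \<zeta>,
      which contains its intersection. So the minimum over all stages is attained at a single
      stage.\<close>
    have hull: "\<exists>E. (\<exists>\<zeta>\<in>Field omega1. E \<in> \<Sigma> \<zeta>) \<and> P \<subseteq> E \<and>
        (\<forall>\<zeta>\<in>Field omega1. \<forall>E'\<in>\<Sigma> \<zeta>. P \<subseteq> E' \<longrightarrow> measure \<nu> E \<le> measure \<nu> E')" if P: "P \<subseteq> topspace K" for P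
    proof -
      define M where "M = {measure \<nu> E | E. (\<exists>\<zeta>\<in>Field omega1. E \<in> \<Sigma> \<zeta>) \<and> P \<subseteq> E}"
      have M_bdd: "bdd_below M" unfolding M_def by (rule bdd_belowI[of _ 0]) auto
      obtain \<zeta>0 where \<zeta>0: "\<zeta>0 \<in> Field omega1" using countable_bounded_omega1[of "{}"] by auto
      have "topspace K \<in> \<Sigma> \<zeta>0" unfolding \<Sigma>_def by (rule sigma_sets_top)
      then have M_ne: "M \<noteq> {}" using \<zeta>0 P unfolding M_def by blast
      have "\<forall>n. \<exists>E. (\<exists>\<zeta>\<in>Field omega1. E \<in> \<Sigma> \<zeta>) \<and> P \<subseteq> E \<and> measure \<nu> E < Inf M + inverse (real (Suc n))"
      proof
        fix n
        have "Inf M < Inf M + inverse (real (Suc n))" by simp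
        from cInf_lessD[OF M_ne this]
        show "\<exists>E. (\<exists>\<zeta>\<in>Field omega1. E \<in> \<Sigma> \<zeta>) \<and> P \<subseteq> E \<and> measure \<nu> E < Inf M + inverse (real (Suc n))"
          unfolding M_def by blast
      qed
      from choice[OF this] obtain E where E: "\<forall>n. (\<exists>\<zeta>\<in>Field omega1. E n \<in> \<Sigma> \<zeta>) \<and> P \<subseteq> E n \<and>
          measure \<nu> (E n) < Inf M + inverse (real (Suc n))" ..
      obtain \<zeta> where \<zeta>: "\<zeta> \<in> Field omega1" "\<forall>n\<in>UNIV. E n \<in> \<Sigma> \<zeta>"
        using \<Sigma>_common[of "UNIV :: nat set" E] E by auto
      have "(\<Inter>n. E n) \<in> \<Sigma> \<zeta>"
        using \<zeta>(2) unfolding \<Sigma>_def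
        by (intro sigma_sets_INTER) (auto dest: openin_subset[OF U_open, THEN subsetD])
      moreover have "measure \<nu> (\<Inter>n. E n) \<le> Inf M"
      proof -
        have "measure \<nu> (\<Inter>n. E n) \<le> Inf M + inverse (real (Suc n))" for n
        proof -
          have "measure \<nu> (\<Inter>n. E n) \<le> measure \<nu> (E n)"
            using \<zeta>(2) \<Sigma>_sets by (intro \<nu>.finite_measure_mono) (auto simp: \<nu>(2))
          then show ?thesis using E by (meson le_less_trans less_imp_le)
        qed
        moreover have "(\<lambda>n. Inf M + inverse (real (Suc n))) \<longlonglongrightarrow> Inf M + 0"
          by (intro tendsto_add tendsto_const LIMSEQ_inverse_real_of_nat)
        ultimately show ?thesis by (intro LIMSEQ_le_const[of _ "Inf M"]) auto
      qed
      moreover have "Inf M \<le> measure \<nu> E'" if "\<xi> \<in> Field omega1" "E' \<in> \<Sigma> \<xi>" "P \<subseteq> E'" for E' \<xi>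
        using that by (intro cInf_lower[OF _ M_bdd]) (auto simp: M_def)
      ultimately show ?thesis
        using \<zeta>(1) E by (intro exI[of _ "\<Inter>n. E n"]) (auto intro: order_trans)
    qed
    define V where "V = (\<lambda>(\<zeta>, k). U \<zeta> k)"
    have V_sets: "V i \<in> sets \<mu>" for i by (cases i) (simp add: V_def U_sets)
    have J: "|Field omega1 \<times> (UNIV :: nat set)| \<le>o omega1"
      using Cinfinite_omega1 by (intro Times_ordLeq ordIso_imp_ordLeq[OF card_of_Field_ordIso] Cinfinite_natLeq_le) auto
    \<comment> \<open>The event that the point belongs to the whole family of stage \<zeta>, null by
      \<open>U_null\<close>.\<close>
    define N where "N \<zeta> = {t :: nat set \<times> nat \<Rightarrow> bool. \<forall>k. t (\<zeta>, k)}" for \<zeta>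
    have N_null: "N \<zeta> \<in> null_sets (law \<nu> V)" for \<zeta>
    proof -
      have "{t \<in> space bits. \<forall>k. t (\<zeta>, k)} \<in> sets (bits :: (nat set \<times> nat \<Rightarrow> bool) measure)" by measurable
      then have N: "N \<zeta> \<in> sets bits" by (simp add: N_def)
      have "{x \<in> topspace K. (\<lambda>i. x \<in> V i) \<in> N \<zeta>} = (\<Inter>k. U \<zeta> k)"
        using openin_subset[OF U_open[of \<zeta> 0]] by (auto simp: N_def V_def)
      then have "emeasure (law \<nu> V) (N \<zeta>) = 0"
        using law_props(3)[OF \<nu>(1,2), of V, OF V_sets N] U_null[of \<zeta>] by (simp add: \<nu>.emeasure_eq_measure)
      then show ?thesis using N law_props(2)[OF \<nu>(1,2), of V, OF V_sets] by (simp add: null_sets_def)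
    qed
    have N_small: "|N ` Field omega1| \<le>o omega1"
      using Cinfinite_omega1 by (intro card_image_ordLeq ordIso_imp_ordLeq[OF card_of_Field_ordIso]) auto
    have N_sub: "N ` Field omega1 \<subseteq> null_sets (law \<nu> V)" using N_null by auto
    have none: "|{} :: (nat set \<times> nat \<Rightarrow> bool) set set| \<le>o omega1"
      by (intro countable_ordLeq Cinfinite_omega1) simp
    obtain t :: "nat \<Rightarrow> nat set \<times> nat \<Rightarrow> bool" and xs where "\<And>n M. M \<in> N ` Field omega1 \<Longrightarrow> t n \<notin> M"
      and xs: "\<And>n. xs n \<in> topspace K"
        "\<And>n i. i \<in> Field omega1 \<times> UNIV \<Longrightarrow> \<not> t n i \<Longrightarrow> xs n \<in> K closure_of (topspace K - V i)"
      by (rule exists_random_points[OF \<nu>(1,2), of V "Field omega1 \<times> UNIV" "N ` Field omega1" "{}",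
            OF V_sets J N_sub N_small _ none]) (simp, blast)
    then have t: "t n \<notin> N \<zeta>" if "\<zeta> \<in> Field omega1" for n \<zeta> using that by blast
    define x where "x = xs 0"
    have x: "x \<in> topspace K" by (simp add: x_def xs)
    \<comment> \<open>Some bit of stage \<zeta> is false, which puts \<open>x\<close> in the closure
      of the complement of an open set, that is, in the complement itself.\<close>
    have x_avoids: "\<exists>k. x \<notin> U \<zeta> k" if \<zeta>: "\<zeta> \<in> Field omega1" for \<zeta>
    proof -
      obtain k where "\<not> t 0 (\<zeta>, k)" using t[OF \<zeta>, of 0] by (auto simp: N_def)
      then have "x \<in> K closure_of (topspace K - U \<zeta> k)"
        using xs(2)[of "(\<zeta>, k)" 0] \<zeta> by (simp add: V_def x_def)
      moreover have "closedin K (topspace K - U \<zeta> k)" using U_open by auto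
      ultimately show ?thesis by (auto simp: closure_of_closedin)
    qed
    obtain \<P> where \<P>: "countable \<P>" "pi_base_at K x \<P>"
      using pi_character x by (auto simp: countable_pi_character_def)
    have \<P>_open: "openin K P" "P \<noteq> {}" if "P \<in> \<P>" for P
      using \<P>(2) that by (auto simp: pi_base_at_def)
    have "\<forall>P\<in>\<P>. \<exists>E. (\<exists>\<zeta>\<in>Field omega1. E \<in> \<Sigma> \<zeta>) \<and> P \<subseteq> E \<and>
        (\<forall>\<zeta>\<in>Field omega1. \<forall>E'\<in>\<Sigma> \<zeta>. P \<subseteq> E' \<longrightarrow> measure \<nu> E \<le> measure \<nu> E')"
    proof
      fix P assume "P \<in> \<P>"
      then show "\<exists>E. (\<exists>\<zeta>\<in>Field omega1. E \<in> \<Sigma> \<zeta>) \<and> P \<subseteq> E \<and>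
          (\<forall>\<zeta>\<in>Field omega1. \<forall>E'\<in>\<Sigma> \<zeta>. P \<subseteq> E' \<longrightarrow> measure \<nu> E \<le> measure \<nu> E')"
        by (intro hull openin_subset \<P>_open(1))
    qed
    from bchoice[OF this] obtain E where E: "\<forall>P\<in>\<P>. (\<exists>\<zeta>\<in>Field omega1. E P \<in> \<Sigma> \<zeta>) \<and> P \<subseteq> E P \<and>
        (\<forall>\<zeta>\<in>Field omega1. \<forall>E'\<in>\<Sigma> \<zeta>. P \<subseteq> E' \<longrightarrow> measure \<nu> (E P) \<le> measure \<nu> E')" ..
    obtain \<zeta> where \<zeta>: "\<zeta> \<in> Field omega1" "\<forall>P\<in>\<P>. E P \<in> \<Sigma> \<zeta>"
    proof -
      have "\<forall>P\<in>\<P>. \<exists>\<zeta>\<in>Field omega1. E P \<in> \<Sigma> \<zeta>" using E by blast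
      from \<Sigma>_common[OF \<P>(1) this] show thesis using that by blast
    qed
    obtain k where k: "x \<notin> U \<zeta> k" using x_avoids[OF \<zeta>(1)] by blast
    \<comment> \<open>Passing from \<open>k\<close> to \<open>Suc k\<close> gains a closure:
      \<open>x\<close> is not in \<open>U \<zeta> k\<close>, hence outside the closure of
      \<open>U \<zeta> (Suc k)\<close>, and in \<open>W\<close> by \<open>U_W\<close>.\<close>
    have "openin K (W - K closure_of U \<zeta> (Suc k))" using W by (intro openin_diff) auto
    moreover have "x \<in> W - K closure_of U \<zeta> (Suc k)" using k U_Suc U_W x by blast
    ultimately obtain P where P: "P \<in> \<P>" "P \<subseteq> W - K closure_of U \<zeta> (Suc k)"
      using \<P>(2) unfolding pi_base_at_def by blast
    have P_sets: "P \<in> sets \<mu>" by (rule open_sets[OF \<P>_open(1)[OF P(1)]])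
    have E_sets: "E P \<in> sets \<mu>" using \<zeta>(2) P(1) \<Sigma>_sets by blast
    have "W \<inter> P = P" using P(2) by auto
    moreover have "measure \<mu> P > 0" "measure \<mu> W > 0"
      using positive[OF \<P>_open[OF P(1)]] W_pos measure_pos_iff by auto
    ultimately have "measure \<nu> P > 0" by (simp add: \<nu>(3)[OF P_sets])
    also have "measure \<nu> P \<le> measure \<nu> (E P)"
      using E P(1) E_sets by (intro \<nu>.finite_measure_mono) (auto simp: \<nu>(2))
    finally have "measure \<nu> (E P) > 0" .
    then have meets: "measure \<nu> (E P \<inter> U \<zeta> (Suc k)) > 0"
      using \<zeta>(2) P(1) \<Sigma>_earlier by (intro U_meets) auto
    have "U \<zeta> (Suc k) \<subseteq> K closure_of U \<zeta> (Suc k)"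
      by (rule closure_of_subset[OF openin_subset[OF U_open]])
    then have sub: "P \<subseteq> E P - U \<zeta> (Suc k)" using E P by blast
    \<comment> \<open>\<open>U \<zeta> (Suc k)\<close> is among the generators only after stage
      \<zeta>. As the hull is minimal over all stages, it may be compared with a set from a later
      one.\<close>
    obtain \<zeta>' where \<zeta>': "\<zeta>' \<in> Field omega1" "\<zeta> \<in> underS omega1 \<zeta>'"
      using countable_bounded_omega1[of "{\<zeta>}"] \<zeta>(1) by auto
    have "E P - U \<zeta> (Suc k) \<in> \<Sigma> \<zeta>'"
    proof -
      have "sigma_algebra (topspace K) (\<Sigma> \<zeta>')"
        unfolding \<Sigma>_def by (rule sigma_algebra_sigma_sets) (use U_open openin_subset in blast)
      then interpret \<Sigma>: sigma_algebra "topspace K" "\<Sigma> \<zeta>'" .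
      have "U \<zeta> (Suc k) \<in> \<Sigma> \<zeta>'" unfolding \<Sigma>_def using \<zeta>'(2) by (intro sigma_sets.Basic) auto
      moreover have "E P \<in> \<Sigma> \<zeta>'" using \<zeta>(2) P(1) \<Sigma>_mono[OF \<zeta>'(2)] by blast
      ultimately show ?thesis by (rule \<Sigma>.Diff[rotated])
    qed
    then have "measure \<nu> (E P) \<le> measure \<nu> (E P - U \<zeta> (Suc k))"
      using E P(1) \<zeta>'(1) sub by blast
    also have "E P - U \<zeta> (Suc k) = E P - (E P \<inter> U \<zeta> (Suc k))" by auto
    also have "measure \<nu> \<dots> = measure \<nu> (E P) - measure \<nu> (E P \<inter> U \<zeta> (Suc k))"
      using E_sets U_sets by (intro \<nu>.finite_measure_Diff) (auto simp: \<nu>(2))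
    finally show False using meets by simp
  qed
  with D show thesis using that by blast
qed

end

section \<open>From the cardinal hypotheses to the \<pi>-base\<close>

lemma card_nat_set_le_continuum: "|UNIV :: nat set set| \<le>o continuum"
proof -
  have "continuum = |UNIV :: (nat \<Rightarrow> bool) set|"
    unfolding continuum_def cexp_def ctwo_def by (simp add: Field_natLeq Field_card_of Func_def)
  moreover have "|UNIV :: nat set set| \<le>o |UNIV :: (nat \<Rightarrow> bool) set|"
    by (rule card_of_ordLeqI[of "\<lambda>s n. n \<in> s"]) (auto intro!: injI simp: fun_eq_iff)
  ultimately show ?thesis by simp
qed

text \<open>The factor \<open>nat set\<close> dominates the product, so the coin indices number at
  most the continuum, which is \<open>omega2\<close>.\<close>

lemma exists_inj_into_omega2:
  assumes "continuum =o omega2"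
  obtains f :: "nat \<times> (nat set \<times> nat) \<times> nat \<Rightarrow> nat set set" where "inj f" "range f \<subseteq> Field omega2"
proof -
  let ?c = "|UNIV :: nat set set|"
  have c: "Cinfinite ?c"
    by (intro conjI card_of_Card_order) (simp add: cinfinite_def Field_card_of Finite_Set.finite_set)
  have nat: "|UNIV :: nat set| \<le>o ?c" by (rule Cinfinite_natLeq_le[OF c])
  have "|(UNIV :: nat set) \<times> ((UNIV :: nat set set) \<times> (UNIV :: nat set)) \<times> (UNIV :: nat set)| \<le>o ?c"
    by (rule Times_ordLeq[OF c nat Times_ordLeq[OF c Times_ordLeq[OF c card_of_mono1[OF subset_refl] nat] nat]])
  then have "|UNIV :: (nat \<times> (nat set \<times> nat) \<times> nat) set| \<le>o ?c" by simp
  then have "|UNIV :: (nat \<times> (nat set \<times> nat) \<times> nat) set| \<le>o omega2"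
    by (rule ordLeq_transitive[OF _ ordLeq_ordIso_trans[OF card_nat_set_le_continuum assms]])
  moreover have "Card_order omega2"
    unfolding omega2_def by (rule cardSuc_Card_order) (use Cinfinite_omega1 in simp)
  ultimately have "|UNIV :: (nat \<times> (nat set \<times> nat) \<times> nat) set| \<le>o |Field omega2|"
    by (rule ordLeq_ordIso_trans[OF _ ordIso_symmetric[OF card_of_Field_ordIso]])
  then show thesis using that unfolding card_of_ordLeq[symmetric] by blast
qed

lemma cov_ideal_lower_bound:
  assumes "\<A> \<subseteq> \<I>" "\<Union>\<A> = S"
  shows "cov_ideal S \<I> \<le>o |\<A>|"
proof -
  let ?F = "{\<A>. \<A> \<subseteq> \<I> \<and> \<Union>\<A> = S}"
  have A: "\<A> \<in> ?F" using assms by simp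
  then have "?F \<noteq> {}" by blast
  then obtain X where X: "X \<in> ?F" "min_card ?F = |X|" "\<And>Y. Y \<in> ?F \<Longrightarrow> |X| \<le>o |Y|"
    by (rule min_card_attained) (rule that)
  show ?thesis unfolding cov_ideal_def X(2) by (rule X(3)[OF A])
qed

theorem theorem5p6:
  fixes K :: "'a topology"
  assumes "continuum =o omega2"
    and "non_ideal (cantor_cube (UNIV :: nat set)) (cube_null UNIV) =o omega1"
    and "cov_ideal (cantor_cube (Field omega2)) (cube_null (Field omega2)) =o continuum"
    and "compact_space K" and "Hausdorff_space K"
    and "countable_pi_character K"
    and "supports_measure K"
  shows "\<exists>\<P>. countable \<P> \<and> pi_base K \<P>"
proof -
  obtain \<mu> where radon: "radon_measure_on K \<mu>"
    and positive: "\<And>U. openin K U \<Longrightarrow> U \<noteq> {} \<Longrightarrow> emeasure \<mu> U > 0"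
    using assms(7) by (auto simp: supports_measure_def)
  have small_null: "\<exists>X. X \<notin> null_sets (completion (cube_measure (UNIV :: nat set))) \<and> |X| \<le>o omega1"
  proof -
    let ?F = "{X. X \<subseteq> cantor_cube (UNIV :: nat set) \<and> X \<notin> cube_null UNIV}"
    \<comment> \<open>\<open>min_card\<close> is meaningful only for a nonempty family; the whole
      cube, having measure 1, is a member.\<close>
    have "cantor_cube (UNIV :: nat set) \<notin> cube_null UNIV"
    proof
      assume "cantor_cube (UNIV :: nat set) \<in> cube_null UNIV"
      then have "space (cube_measure (UNIV :: nat set)) \<in> null_sets (cube_measure UNIV)"
        by (simp only: cube_null_def space_cube_measure[symmetric] null_sets_completion_iff sets.top)
      then show False
        using prob_space.emeasure_space_1[OF prob_space_cube[of "UNIV :: nat set"]] by (auto simp: null_sets_def)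
    qed
    then have "?F \<noteq> {}" by blast
    then obtain X where "X \<in> ?F" "min_card ?F = |X|" "\<And>Y. Y \<in> ?F \<Longrightarrow> |X| \<le>o |Y|"
      by (rule min_card_attained) (rule that)
    then show ?thesis
      using assms(2) by (intro exI[of _ X]) (auto simp: non_ideal_def cube_null_def intro: ordIso_imp_ordLeq)
  qed
  obtain f :: "nat \<times> (nat set \<times> nat) \<times> nat \<Rightarrow> nat set set" where f: "inj f" "range f \<subseteq> Field omega2"
    by (rule exists_inj_into_omega2[OF assms(1)])
  have no_cover: "\<Union>\<A> \<noteq> cantor_cube (Field omega2)"
    if A: "\<A> \<subseteq> cube_null (Field omega2)" "|\<A>| \<le>o omega1" for \<A>
  proof
    assume "\<Union>\<A> = cantor_cube (Field omega2)"
    then have "cov_ideal (cantor_cube (Field omega2)) (cube_null (Field omega2)) \<le>o omega1"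
      by (rule ordLeq_transitive[OF cov_ideal_lower_bound[OF A(1)] A(2)])
    then have "omega2 \<le>o omega1"
      by (rule ordIso_ordLeq_trans[OF ordIso_symmetric[OF ordIso_transitive[OF assms(3,1)]]])
    moreover have "omega1 <o omega2"
      unfolding omega2_def by (rule cardSuc_greater) (use Cinfinite_omega1 in simp)
    ultimately show False using not_ordLess_ordLeq by blast
  qed
  interpret strictly_positive_radon K \<mu>
  proof
    show "compact_space K" "Hausdorff_space K" "radon_measure_on K \<mu>" "countable_pi_character K"
      by fact+
    show "Cinfinite omega1" by (rule Cinfinite_omega1)
    show "\<Union>\<N> \<noteq> UNIV" if "\<N> \<subseteq> null_sets (cube_measure (UNIV :: (nat \<times> (nat set \<times> nat) \<times> nat) set))" "|\<N>| \<le>o omega1" for \<N>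
      by (rule cube_not_covered_reindex[OF f no_cover that])
    show "emeasure \<mu> U > 0" if "openin K U" "U \<noteq> {}" for U by (rule positive[OF that])
    show "\<exists>Y. |Y| \<le>o omega1 \<and> (\<forall>B\<in>sets m. emeasure m B > 0 \<longrightarrow> Y \<inter> B \<noteq> {})"
      if m: "prob_space m" "sets m = sets bits" for m :: "(nat \<Rightarrow> bool) measure"
    proof -
      obtain X where X: "X \<notin> null_sets (completion (cube_measure (UNIV :: nat set)))" "|X| \<le>o omega1"
        using small_null by blast
      show ?thesis
        by (rule exists_small_full_set[OF X(1) Cinfinite_omega1 X(2) m]) blast
    qed
  qed
  obtain D where D: "countable D" "D \<subseteq> topspace K" "K closure_of D = topspace K"
    by (rule separable)
  have "\<forall>d\<in>D. \<exists>\<P>. countable \<P> \<and> pi_base_at K d \<P>"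
    using D(2) assms(6) by (auto simp: countable_pi_character_def)
  from bchoice[OF this] obtain \<P> where \<P>: "\<forall>d\<in>D. countable (\<P> d) \<and> pi_base_at K d (\<P> d)" ..
  \<comment> \<open>A nonempty open set contains a point \<open>d\<close> of the dense set, hence a
    member of the \<pi>-base at \<open>d\<close>.\<close>
  have "pi_base K (\<Union>d\<in>D. \<P> d)"
    unfolding pi_base_def
  proof (intro conjI allI impI ballI)
    show "openin K U" "U \<noteq> {}" if "U \<in> (\<Union>d\<in>D. \<P> d)" for U
      using \<P> that by (auto simp: pi_base_at_def)
    fix V assume V: "openin K V \<and> V \<noteq> {}"
    then obtain x where x: "x \<in> V" "x \<in> K closure_of D" using D(3) openin_subset by blast
    then obtain d where "d \<in> D" "d \<in> V" using V by (auto simp: in_closure_of)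
    with \<P> V obtain U where "U \<in> \<P> d" "U \<subseteq> V" unfolding pi_base_at_def by blast
    with \<open>d \<in> D\<close> show "\<exists>U\<in>\<Union>d\<in>D. \<P> d. U \<subseteq> V" by blast
  qed
  moreover have "countable (\<Union>d\<in>D. \<P> d)" using D(1) \<P> by auto
  ultimately show ?thesis by blast
qed

end
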